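(* Let $n,d\ge 1$ be integers and let $\Sigma=(\Sigma_1,\ldots,\Sigma_n)$ be a fixed tuple of (symmetric) positive-definite $d\times d$ real matrices. Then there is a Lebesgue-null set $N_\Sigma\subset\mathbb R^{nd}$ such that, for every $X=(x_1,\ldots,x_n)\in(\mathbb R^d)^n\cong\mathbb R^{nd}$ with $X\notin N_\Sigma$, the problem $$\sup_{\pi\in\mathcal P(\mathbb R^d)}\ \sum_{i=1}^n\log p_{\pi,i}(x_i)$$ has a unique solution $\widehat\pi$ (exactly one $\widehat\pi\in\mathcal P(\mathbb R^d)$ attains the supremum), and $|\operatorname{supp}(\widehat\pi)|\le n$.
   Context: $\mathcal P(\mathbb R^d)$ denotes the set of Borel probability measures on $\mathbb R^d$. For $i=1,\ldots,n$, $$\varphi_{\Sigma_i}(z)=\frac{\exp(-\tfrac12 z^\top\Sigma_i^{-1}z)}{(2\pi)^{d/2}(\det\Sigma_i)^{1/2}},\qquad p_{\pi,i}(x)=\int_{\mathbb R^d}\varphi_{\Sigma_i}(x-\theta)\,d\pi(\theta)$$ for $z,x\in\mathbb R^d$ and $\pi\in\mathcal P(\mathbb R^d)$ (in the normalizing constant $(2\pi)^{d/2}$, $\pi$ is the number). $\operatorname{supp}(\widehat\pi)$ is the topological support of the measure and $|\cdot|$ denotes cardinality. *)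

theory Defs
  imports "HOL-Probability.Probability"
begin

definition sym_pos_def :: "real^'d^'d \<Rightarrow> bool" where
  "sym_pos_def S \<longleftrightarrow> transpose S = S \<and> (\<forall>z. z \<noteq> 0 \<longrightarrow> 0 < z \<bullet> (S *v z))"

definition gauss_density :: "real^'d^'d \<Rightarrow> real^'d \<Rightarrow> real" where
  "gauss_density S z =
     exp (- (1/2) * (z \<bullet> (matrix_inv S *v z))) / ((2 * pi) powr (real CARD('d) / 2) * sqrt (det S))"

definition mixture_density :: "real^'d^'d \<Rightarrow> (real^'d) measure \<Rightarrow> real^'d \<Rightarrow> real" where
  "mixture_density S \<pi> x = (LINT \<theta>|\<pi>. gauss_density S (x - \<theta>))"

text \<open>For positive definite covariances and a Borel probability measure \<open>\<pi>\<close>, each density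
  value lies in \<open>(0, C]\<close> with \<open>C\<close> independent of \<open>\<pi>\<close>, so the logarithms are genuine and the
  objective is real-valued and bounded above over all \<open>\<pi>\<close>.\<close>

definition log_lik :: "('n::finite \<Rightarrow> real^'d^'d) \<Rightarrow> (real^'d)^'n \<Rightarrow> (real^'d) measure \<Rightarrow> real" where
  "log_lik \<Sigma> X \<pi> = (\<Sum>i\<in>UNIV. ln (mixture_density (\<Sigma> i) \<pi> (X $ i)))"

text \<open>\<open>space (prob_algebra borel)\<close> is the set of Borel probability measures.\<close>

definition is_npmle :: "('n::finite \<Rightarrow> real^'d^'d) \<Rightarrow> (real^'d)^'n \<Rightarrow> (real^'d) measure \<Rightarrow> bool" where
  "is_npmle \<Sigma> X = is_arg_max (log_lik \<Sigma> X) (\<lambda>\<pi>. \<pi> \<in> space (prob_algebra borel))"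

definition topological_support :: "'a::topological_space measure \<Rightarrow> 'a set" where
  "topological_support M = {x. \<forall>U. open U \<longrightarrow> x \<in> U \<longrightarrow> 0 < emeasure M U}"

end

(*
Likelihood vectors (\<phi>\<^sub>i (x\<^sub>i - \<theta>))\<^sub>i vanish at infinity, so the convex hull of their range together
with 0 is compact, and a maximiser of the product of the coordinates comes from a mixing measure.
By strict concavity of the logarithm all maximisers \<pi> share the mixture values.

The maximal log likelihood V is convex along the lines X + t b up to a quadratic term, hence for
almost every X its second symmetric difference quotients at X vanish in finitely many prescribed
directions b (Tonelli). As V dominates the log likelihood of every maximiser and agrees with it at
X, all maximisers then share the moments of \<theta> weighted by \<phi>\<^sub>i (x\<^sub>i - \<theta>).

Fix a maximiser \<pi> and let K be the space of bounded g such that g \<phi>\<^sub>i (x\<^sub>i - \<theta>) has \<pi>-integral 0 for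
every i. For small g in K, (1 + g) \<pi> is again a maximiser, so equality of the moments says that K
is closed under multiplication by the coordinates of \<theta>, hence by continuous functions. This
forces g = 0 \<pi>-almost everywhere, while K has codimension at most n: the support has at most n
points. Applied to the midpoint of two maximisers and the difference of their densities, the same
fact gives uniqueness.
*)
theory Submission
  imports Defs
begin

section \<open>Bounded Borel functions and probability measures\<close>

text \<open>Test functions integrable against every Borel probability measure. The measures
  constructed below are known only through their integrals of such functions.\<close>

definition bounded_borel :: "('a::topological_space \<Rightarrow> real) set" where
  "bounded_borel = {f \<in> borel_measurable borel. \<exists>B. \<forall>x. \<bar>f x\<bar> \<le> B}"

lemma bounded_borelI: "f \<in> borel_measurable borel \<Longrightarrow> (\<And>x. \<bar>f x\<bar> \<le> B) \<Longrightarrow> f \<in> bounded_borel"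
  by (auto simp: bounded_borel_def)

lemma bounded_borel_measurable: "f \<in> bounded_borel \<Longrightarrow> f \<in> borel_measurable borel"
  by (simp add: bounded_borel_def)

lemma bounded_borel_bound: "f \<in> bounded_borel \<Longrightarrow> \<exists>B>0. \<forall>x. \<bar>f x\<bar> \<le> B"
proof -
  assume "f \<in> bounded_borel"
  then obtain B where "\<forall>x. \<bar>f x\<bar> \<le> B" by (auto simp: bounded_borel_def)
  then show ?thesis by (intro exI[of _ "max B 1"]) (auto simp: le_max_iff_disj)
qed

lemma bounded_borel_const: "(\<lambda>x. c) \<in> bounded_borel"
  by (auto simp: bounded_borel_def)

lemma bounded_borel_indicator: "A \<in> sets borel \<Longrightarrow> indicator A \<in> bounded_borel"
  by (rule bounded_borelI[where B=1]) (auto simp: indicator_def)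

lemma bounded_borel_add:
  assumes "f \<in> bounded_borel" "g \<in> bounded_borel"
  shows "(\<lambda>x. f x + g x) \<in> bounded_borel"
proof -
  obtain B C where "\<forall>x. \<bar>f x\<bar> \<le> B" "\<forall>x. \<bar>g x\<bar> \<le> C"
    using assms by (auto simp: bounded_borel_def)
  then have "\<bar>f x + g x\<bar> \<le> B + C" for x
    by (meson abs_triangle_ineq add_mono order_trans)
  then show ?thesis
    by (rule bounded_borelI[where B="B + C", OF borel_measurable_add[OF assms[THEN bounded_borel_measurable]]])
qed

lemma bounded_borel_mult:
  assumes "f \<in> bounded_borel" "g \<in> bounded_borel"
  shows "(\<lambda>x. f x * g x) \<in> bounded_borel"
proof -
  obtain B C where "\<forall>x. \<bar>f x\<bar> \<le> B" "\<forall>x. \<bar>g x\<bar> \<le> C"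
    using assms by (auto simp: bounded_borel_def)
  then have "\<bar>f x * g x\<bar> \<le> B * C" for x
    unfolding abs_mult by (meson abs_ge_zero mult_mono order_trans)
  then show ?thesis
    by (rule bounded_borelI[where B="B * C", OF borel_measurable_times[OF assms[THEN bounded_borel_measurable]]])
qed

lemma bounded_borel_cmult: "f \<in> bounded_borel \<Longrightarrow> (\<lambda>x. c * f x) \<in> bounded_borel"
  by (rule bounded_borel_mult[OF bounded_borel_const])

lemma bounded_borel_sum:
  "(\<And>i. i \<in> I \<Longrightarrow> f i \<in> bounded_borel) \<Longrightarrow> (\<lambda>x. \<Sum>i\<in>I. f i x) \<in> bounded_borel"
  by (induction I rule: infinite_finite_induct) (simp_all add: bounded_borel_const bounded_borel_add)

lemma bounded_borel_continuous_compact: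
  fixes f :: "'a::euclidean_space \<Rightarrow> real"
  assumes "continuous_on UNIV f" "compact C"
  shows "(\<lambda>x. indicator C x * f x) \<in> bounded_borel"
proof -
  have "bounded (f ` C)"
    using assms by (meson compact_continuous_image compact_imp_bounded continuous_on_subset subset_UNIV)
  then obtain B where B: "\<forall>x\<in>C. \<bar>f x\<bar> \<le> B"
    by (auto simp: bounded_iff)
  have "f \<in> borel_measurable borel"
    using assms(1) by (rule borel_measurable_continuous_onI)
  moreover have "C \<in> sets borel"
    using assms(2) by (simp add: borel_closed compact_imp_closed)
  ultimately show ?thesis
    using B by (intro bounded_borelI[where B="max B 0"]) (auto simp: indicator_def max_def)
qed

lemma integrable_bounded_borel:
  assumes "\<pi> \<in> space (prob_algebra borel)" "f \<in> bounded_borel"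
  shows "integrable \<pi> f"
proof -
  interpret prob_space \<pi> using assms by (simp add: space_prob_algebra)
  have "sets \<pi> = sets borel" using assms by (simp add: space_prob_algebra)
  then have "f \<in> borel_measurable \<pi>"
    using bounded_borel_measurable[OF assms(2)] measurable_cong_sets by blast
  then show ?thesis
    using bounded_borel_bound[OF assms(2)] by (auto intro!: integrable_const_bound[of f] AE_I2)
qed

lemma integral_pos_prob:
  fixes f :: "'a::topological_space \<Rightarrow> real"
  assumes "\<pi> \<in> space (prob_algebra borel)" "f \<in> bounded_borel" "\<And>x. 0 \<le> f x"
    "emeasure \<pi> {x. 0 < f x} \<noteq> 0"
  shows "0 < (LINT x|\<pi>. f x)"
proof -
  have s: "sets \<pi> = sets borel" "space \<pi> = UNIV"
    using assms(1) by (auto simp: space_prob_algebra dest: sets_eq_imp_space_eq)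
  have "integral\<^sup>L \<pi> f \<noteq> 0"
  proof
    assume "integral\<^sup>L \<pi> f = 0"
    then have "AE x in \<pi>. f x = 0"
      using integral_nonneg_eq_0_iff_AE[OF integrable_bounded_borel[OF assms(1,2)]] assms(3) by simp
    then have "AE x in \<pi>. x \<notin> {x. 0 < f x}"
      by eventually_elim simp
    moreover have "{x. 0 < f x} \<in> sets \<pi>"
      unfolding s using bounded_borel_measurable[OF assms(2)] by measurable
    ultimately show False
      using assms(4) AE_iff_null_sets[of "{x. 0 < f x}" \<pi>] by auto
  qed
  then show ?thesis
    by (simp add: assms(3) order.strict_iff_order)
qed

text \<open>A Bernoulli choice between the two measures, bound to the chosen measure, realises the
  convex combination.\<close>

lemma prob_mixture_exists:
  fixes \<pi>\<^sub>0 \<pi>\<^sub>1 :: "'a::topological_space measure"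
  assumes "\<pi>\<^sub>0 \<in> space (prob_algebra borel)" "\<pi>\<^sub>1 \<in> space (prob_algebra borel)" "0 \<le> a" "a \<le> 1"
  shows "\<exists>\<pi>\<in>space (prob_algebra borel). \<forall>f\<in>bounded_borel.
    (LINT x|\<pi>. f x) = (1 - a) * (LINT x|\<pi>\<^sub>0. f x) + a * (LINT x|\<pi>\<^sub>1. f x)"
proof -
  let ?K = "\<lambda>b. if b then \<pi>\<^sub>1 else \<pi>\<^sub>0"
  let ?\<pi> = "measure_pmf (bernoulli_pmf a) \<bind> ?K"
  have K: "?K \<in> measure_pmf (bernoulli_pmf a) \<rightarrow>\<^sub>M prob_algebra borel"
    using assms by (simp add: measurable_def)
  have p: "measure_pmf (bernoulli_pmf a) \<in> space (prob_algebra (measure_pmf (bernoulli_pmf a)))"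
    by (simp add: space_prob_algebra measure_pmf.prob_space_axioms)
  show ?thesis
  proof (intro bexI ballI)
    show "?\<pi> \<in> space (prob_algebra borel)"
      using prob_space_bind'[OF p K] sets_bind'[OF p K] by (simp add: space_prob_algebra)
    fix f :: "'a \<Rightarrow> real"
    assume "f \<in> bounded_borel"
    then obtain B where f: "f \<in> borel_measurable borel" and B: "\<forall>x. \<bar>f x\<bar> \<le> B"
      by (auto simp: bounded_borel_def)
    have "(LINT x|?\<pi>. f x) = (LINT b|measure_pmf (bernoulli_pmf a). LINT x|?K b. f x)"
    proof (rule integral_bind[OF f _ measurable_prob_algebraD[OF K]])
      show "AE x in measure_pmf (bernoulli_pmf a). emeasure (if x then \<pi>\<^sub>1 else \<pi>\<^sub>0) (space (if x then \<pi>\<^sub>1 else \<pi>\<^sub>0)) \<le> ennreal 1"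
        using assms by (auto simp: space_prob_algebra prob_space.emeasure_space_1)
    qed (use B measure_pmf.finite_measure_axioms in auto)
    then show "(LINT x|?\<pi>. f x) = (1 - a) * (LINT x|\<pi>\<^sub>0. f x) + a * (LINT x|\<pi>\<^sub>1. f x)"
      using assms by simp
  qed
qed

text \<open>\<open>h\<close> divided by its integral is a probability density. This serves both for
  conditioning on a ball and for perturbing a maximiser.\<close>

lemma prob_reweight:
  fixes \<pi> :: "'a::topological_space measure"
  assumes \<pi>: "\<pi> \<in> space (prob_algebra borel)" and h: "h \<in> bounded_borel" "\<And>x. 0 \<le> h x"
    and c: "0 < (LINT x|\<pi>. h x)"
  shows "\<exists>\<rho>\<in>space (prob_algebra borel). \<forall>f\<in>bounded_borel.
    (LINT x|\<rho>. f x) = (LINT x|\<pi>. h x * f x) / (LINT x|\<pi>. h x)"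
proof -
  let ?c = "LINT x|\<pi>. h x"
  let ?\<rho> = "density \<pi> (\<lambda>x. ennreal (h x / ?c))"
  have s: "sets \<pi> = sets borel"
    using \<pi> by (simp add: space_prob_algebra)
  have meas: "f \<in> borel_measurable \<pi>" if "f \<in> bounded_borel" for f :: "'a \<Rightarrow> real"
    using that s by (simp add: bounded_borel_def cong: measurable_cong_sets)
  have hm: "(\<lambda>x. h x / ?c) \<in> borel_measurable \<pi>"
    using meas[OF h(1)] by measurable
  show ?thesis
  proof (intro bexI ballI)
    have "emeasure ?\<rho> (space ?\<rho>) = (\<integral>\<^sup>+x. ennreal (h x / ?c) \<partial>\<pi>)"
      using hm by (simp add: emeasure_density cong: nn_integral_cong)
    also have "\<dots> = ennreal (LINT x|\<pi>. h x / ?c)"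
      using h c integrable_bounded_borel[OF \<pi> h(1)] by (intro nn_integral_eq_integral) auto
    also have "\<dots> = 1" using c by simp
    finally show "?\<rho> \<in> space (prob_algebra borel)"
      by (simp add: space_prob_algebra s prob_spaceI)
    fix f :: "'a \<Rightarrow> real" assume "f \<in> bounded_borel"
    then have "(LINT x|?\<rho>. f x) = (LINT x|\<pi>. h x / ?c * f x)"
      using h c hm by (subst integral_density) (auto intro: meas)
    then show "(LINT x|?\<rho>. f x) = (LINT x|\<pi>. h x * f x) / ?c"
      by simp
  qed
qed

text \<open>The complement of the support is the union of all open null sets; by Lindelof countably
  many of them already cover it.\<close>

lemma AE_topological_support:
  fixes \<pi> :: "'a::second_countable_topology measure"
  assumes "sets \<pi> = sets borel"
  shows "AE x in \<pi>. x \<in> topological_support \<pi>"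
proof -
  let ?F = "{U. open U \<and> emeasure \<pi> U = 0}"
  obtain F' where F': "F' \<subseteq> ?F" "countable F'" "\<Union>F' = \<Union>?F"
    by (rule Lindelof[of ?F]) auto
  have "\<Union>F' \<in> null_sets \<pi>"
    using F' assms by (intro null_sets_UN'[of _ id, simplified]) (auto simp: null_sets_def)
  moreover have "{x \<in> space \<pi>. x \<notin> topological_support \<pi>} \<subseteq> \<Union>F'"
    unfolding F'(3) by (auto simp: topological_support_def not_gr_zero)
  ultimately show ?thesis
    by (rule AE_I')
qed

lemma integral_finite_support:
  fixes f :: "'a::t1_space \<Rightarrow> real"
  assumes \<pi>: "\<pi> \<in> space (prob_algebra borel)" and S: "finite S" "AE x in \<pi>. x \<in> S"
    and f: "f \<in> borel_measurable borel"
  shows "(LINT x|\<pi>. f x) = (\<Sum>s\<in>S. f s * measure \<pi> {s})"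
proof -
  interpret prob_space \<pi> using \<pi> by (simp add: space_prob_algebra)
  have s: "sets \<pi> = sets borel" using \<pi> by (simp add: space_prob_algebra)
  have "(LINT x|\<pi>. f x) = (LINT x|\<pi>. (\<Sum>s\<in>S. f s * indicator {s} x))"
  proof (rule integral_cong_AE)
    show "AE x in \<pi>. f x = (\<Sum>s\<in>S. f s * indicator {s} x)"
      using S(2) by eventually_elim (use S(1) in \<open>simp add: indicator_def sum.delta if_distrib cong: if_cong\<close>)
  qed (use f in \<open>auto simp: s cong: measurable_cong_sets\<close>)
  also have "\<dots> = (\<Sum>s\<in>S. f s * measure \<pi> {s})"
    by (subst Bochner_Integration.integral_sum) (auto simp: s less_top[symmetric])
  finally show ?thesis .
qed

text \<open>The vectors form an indexed family: if two indices carry the same vector, coefficients 1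
  and -1 suffice; otherwise the image has too many elements to be independent.\<close>

lemma nontrivial_linear_relation:
  fixes v :: "'b \<Rightarrow> 'a::euclidean_space"
  assumes "finite T" "DIM('a) < card T"
  shows "\<exists>a. (\<exists>s\<in>T. a s \<noteq> (0::real)) \<and> (\<Sum>s\<in>T. a s *\<^sub>R v s) = 0"
proof (cases "inj_on v T")
  case True
  then have "dependent (v ` T)"
    using assms by (intro dependent_biggerset) (simp add: card_image)
  then obtain u where u: "\<exists>y\<in>v ` T. u y \<noteq> 0" "(\<Sum>y\<in>v ` T. u y *\<^sub>R y) = 0"
    using assms by (auto simp: dependent_finite)
  then show ?thesis
    using True by (intro exI[of _ "u \<circ> v"]) (auto simp: sum.reindex)
next
  case False
  then obtain s t where st: "s \<in> T" "t \<in> T" "s \<noteq> t" "v s = v t"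
    by (auto simp: inj_on_def)
  define a :: "'b \<Rightarrow> real" where "a = (\<lambda>x. if x = s then 1 else if x = t then -1 else 0)"
  have "(\<Sum>x\<in>T. a x *\<^sub>R v x) = (\<Sum>x\<in>{s,t}. a x *\<^sub>R v x)"
    using st assms by (intro sum.mono_neutral_right) (auto simp: a_def)
  also have "\<dots> = 0" using st by (simp add: a_def)
  finally show ?thesis using st by (intro exI[of _ a]) (auto simp: a_def)
qed

section \<open>Convexity along lines and null sets\<close>

text \<open>The second difference is divided by the step, not by its square, so its limit is the
  jump of the one-sided derivatives. A monotone subgradient jumps at only countably many
  points.\<close>

lemma convex_countable_nonzero_symmetric_difference:
  fixes w :: "real \<Rightarrow> real"
  assumes "convex_on UNIV w"
  shows "countable {t. \<not> (\<lambda>k. real (Suc k) * (w (t + 1 / Suc k) + w (t - 1 / Suc k) - 2 * w t)) \<longlonglongrightarrow> 0}"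
proof -
  \<comment> \<open>The infimum of the slopes to the right is the right derivative, one choice of
    subgradient.\<close>
  define R where "R x = Inf ((\<lambda>t. (w x - w t) / (x - t)) ` ({x<..} \<inter> UNIV))" for x
  have R: "w x + R x * (y - x) \<le> w y" for x y
    unfolding R_def by (rule convex_le_Inf_differential[OF assms]) auto
  have "mono R"
  proof (rule monoI)
    fix x y :: real assume "x \<le> y"
    moreover have "(R y - R x) * (y - x) \<ge> 0"
      using R[of x y] R[of y x] by (simp add: algebra_simps)
    ultimately show "R x \<le> R y"
      by (cases "x = y") (auto simp: zero_le_mult_iff)
  qed
  have "(\<lambda>k. real (Suc k) * (w (t + 1 / Suc k) + w (t - 1 / Suc k) - 2 * w t)) \<longlonglongrightarrow> 0"
    if t: "isCont R t" for t
  proof (rule tendsto_sandwich[OF _ _ tendsto_const])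
    let ?h = "\<lambda>k. 1 / real (Suc k)"
    have h: "?h \<longlonglongrightarrow> 0"
      using LIMSEQ_inverse_real_of_nat by (simp add: inverse_eq_divide)
    have "(\<lambda>k. t + ?h k) \<longlonglongrightarrow> t" "(\<lambda>k. t - ?h k) \<longlonglongrightarrow> t"
      using tendsto_add[OF tendsto_const h, of t] tendsto_diff[OF tendsto_const h, of t] by simp_all
    then have "(\<lambda>k. R (t + ?h k)) \<longlonglongrightarrow> R t" "(\<lambda>k. R (t - ?h k)) \<longlonglongrightarrow> R t"
      using isCont_tendsto_compose[OF t] by blast+
    from tendsto_diff[OF this] show "(\<lambda>k. R (t + ?h k) - R (t - ?h k)) \<longlonglongrightarrow> 0"
      by simp
    \<comment> \<open>The supporting lines at the two outer points are evaluated at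
      \<open>t\<close>; the lower bound further down uses the supporting line at \<open>t\<close>
      instead.\<close>
    have "w (t + ?h k) + w (t - ?h k) - 2 * w t \<le> ?h k * (R (t + ?h k) - R (t - ?h k))" for k
      using R[of "t + ?h k" t] R[of "t - ?h k" t] by (simp add: algebra_simps)
    then have "real (Suc k) * (w (t + ?h k) + w (t - ?h k) - 2 * w t)
      \<le> real (Suc k) * (?h k * (R (t + ?h k) - R (t - ?h k)))" for k
      by (intro mult_left_mono) auto
    then show "\<forall>\<^sub>F k in sequentially. real (Suc k) * (w (t + ?h k) + w (t - ?h k) - 2 * w t) \<le> R (t + ?h k) - R (t - ?h k)"
      by (intro always_eventually allI) (simp del: of_nat_Suc)
    have "0 \<le> w (t + ?h k) + w (t - ?h k) - 2 * w t" for k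
      using R[of t "t + ?h k"] R[of t "t - ?h k"] by (simp add: algebra_simps)
    then show "\<forall>\<^sub>F k in sequentially. 0 \<le> real (Suc k) * (w (t + ?h k) + w (t - ?h k) - 2 * w t)"
      by (intro always_eventually allI mult_nonneg_nonneg) auto
  qed
  then show ?thesis
    by (intro countable_subset[OF _ mono_ctble_discont[OF \<open>mono R\<close>]]) auto
qed

text \<open>Tonelli for the indicator of \<open>x + t *\<^sub>R b \<in> N\<close>: integrating over
  \<open>t\<close> first gives 0, while integrating over \<open>x\<close> first gives, by
  translation invariance, the measure of \<open>N\<close> for every \<open>t\<close>.\<close>

lemma null_sets_lborel_if_countable_on_lines:
  fixes N :: "'a::euclidean_space set"
  assumes N: "N \<in> sets borel" and lines: "\<And>x. countable {t::real. x + t *\<^sub>R b \<in> N}"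
  shows "N \<in> null_sets lborel"
proof -
  note N[measurable]
  have "(\<lambda>(x, t). indicator N (x + t *\<^sub>R b) :: ennreal) \<in> borel_measurable (lborel \<Otimes>\<^sub>M lborel)"
    by measurable
  from lborel_pair.Fubini'[OF this]
  have "(\<integral>\<^sup>+t. \<integral>\<^sup>+x. indicator N (x + t *\<^sub>R b) \<partial>lborel \<partial>lborel)
      = (\<integral>\<^sup>+x. \<integral>\<^sup>+t. indicator N (x + t *\<^sub>R b) \<partial>lborel \<partial>lborel)" .
  also have "\<dots> = (\<integral>\<^sup>+x. 0 \<partial>(lborel :: 'a measure))"
  proof (rule nn_integral_cong)
    fix x :: 'a
    have "(\<integral>\<^sup>+t. indicator N (x + t *\<^sub>R b) \<partial>lborel) = (\<integral>\<^sup>+t. indicator {t. x + t *\<^sub>R b \<in> N} t \<partial>lborel)"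
      by (simp add: indicator_def)
    also have "\<dots> = 0"
      using emeasure_lborel_countable[OF lines[of x]] lines[of x]
      by (subst nn_integral_indicator) (auto intro: countable_imp_null_set_lborel)
    finally show "(\<integral>\<^sup>+t. indicator N (x + t *\<^sub>R b) \<partial>lborel) = 0" .
  qed
  finally have "(\<integral>\<^sup>+t. \<integral>\<^sup>+x. indicator N (x + t *\<^sub>R b) \<partial>lborel \<partial>lborel) = 0"
    by simp
  moreover have "(\<integral>\<^sup>+x. indicator N (x + t *\<^sub>R b) \<partial>lborel) = emeasure lborel N" for t
  proof -
    have "emeasure lborel N = (\<integral>\<^sup>+x. indicator N x \<partial>distr lborel borel ((+) (t *\<^sub>R b)))"
      using N by (simp add: lborel_distr_plus)
    also have "\<dots> = (\<integral>\<^sup>+x. indicator N (t *\<^sub>R b + x) \<partial>lborel)"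
      using N by (intro nn_integral_distr) auto
    finally show ?thesis by (simp add: add.commute)
  qed
  \<comment> \<open>The infinite factor is the length of the real line over which \<open>t\<close>
    ranges.\<close>
  ultimately have "emeasure lborel N * \<infinity> = 0"
    by simp
  then show ?thesis
    using N by (simp add: null_sets_def ennreal_mult_eq_top_iff)
qed

text \<open>All quantifiers range over the naturals, so that measurability of a convergence set
  follows from countable unions and intersections.\<close>

lemma LIMSEQ_0_iff_nat:
  fixes f :: "nat \<Rightarrow> real"
  shows "f \<longlonglongrightarrow> 0 \<longleftrightarrow> (\<forall>j. \<exists>K. \<forall>k\<ge>K. \<bar>f k\<bar> < 1 / Suc j)"
proof
  assume "f \<longlonglongrightarrow> 0"
  then show "\<forall>j. \<exists>K. \<forall>k\<ge>K. \<bar>f k\<bar> < 1 / Suc j"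
    by (auto simp: LIMSEQ_iff)
next
  assume *: "\<forall>j. \<exists>K. \<forall>k\<ge>K. \<bar>f k\<bar> < 1 / Suc j"
  show "f \<longlonglongrightarrow> 0"
    unfolding LIMSEQ_iff
  proof (intro allI impI)
    fix r :: real assume "0 < r"
    then obtain j where "inverse (real (Suc j)) < r" using reals_Archimedean by blast
    then show "\<exists>K. \<forall>k\<ge>K. norm (f k - 0) < r"
      using *[rule_format, of j] by (force simp: inverse_eq_divide)
  qed
qed

lemma borel_set_not_LIMSEQ_0:
  fixes q :: "nat \<Rightarrow> 'a::topological_space \<Rightarrow> real"
  assumes "\<And>k. q k \<in> borel_measurable borel"
  shows "{x. \<not> (\<lambda>k. q k x) \<longlonglongrightarrow> 0} \<in> sets borel"
proof -
  note assms[measurable]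
  show ?thesis
    unfolding LIMSEQ_0_iff_nat by measurable
qed

text \<open>The quadratic remainder of the logarithm at \<open>h * c\<close> is still of order
  \<open>h\<close> after division by \<open>h\<close>, so it disappears in difference
  quotients.\<close>

lemma scaled_ln_lower_bound:
  fixes c h :: real
  assumes "0 < h" "h * \<bar>c\<bar> \<le> 1/2"
  shows "c - 2 * h * c\<^sup>2 \<le> ln (1 + h * c) / h"
proof -
  have "\<bar>ln (1 + h * c) - h * c\<bar> \<le> 2 * (h * c)\<^sup>2"
    using assms by (intro abs_ln_one_plus_x_minus_x_bound) (simp add: abs_mult)
  then have "h * c - 2 * (h * c)\<^sup>2 \<le> ln (1 + h * c)" by (simp add: abs_le_iff)
  then show ?thesis
    using assms(1) by (simp add: field_simps power2_eq_square)
qed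

section \<open>Maximum likelihood mixing measures\<close>

text \<open>The data vector is frozen: \<open>L i \<theta>\<close> stands for the density of the
  \<open>i\<close>-th observation under location \<open>\<theta>\<close>. Existence, bounded support
  and perturbation of maximisers depend on the Gaussian form only through these three
  properties.\<close>

locale likelihood_family =
  fixes L :: "'n::finite \<Rightarrow> 'a::euclidean_space \<Rightarrow> real"
  assumes L_pos: "0 < L i \<theta>"
    and L_cont: "continuous_on UNIV (L i)"
    and L_vanish: "(L i \<longlongrightarrow> 0) at_infinity"
begin

definition mix :: "'a measure \<Rightarrow> 'n \<Rightarrow> real" where
  "mix \<pi> i = (LINT \<theta>|\<pi>. L i \<theta>)"

definition loglik :: "'a measure \<Rightarrow> real" where
  "loglik \<pi> = (\<Sum>i\<in>UNIV. ln (mix \<pi> i))"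

definition optimal :: "'a measure \<Rightarrow> bool" where
  "optimal = is_arg_max loglik (\<lambda>\<pi>. \<pi> \<in> space (prob_algebra borel))"

lemma optimal_prob: "optimal \<pi> \<Longrightarrow> \<pi> \<in> space (prob_algebra borel)"
  by (simp add: optimal_def is_arg_max_def)

lemma optimal_le: "optimal \<pi> \<Longrightarrow> \<rho> \<in> space (prob_algebra borel) \<Longrightarrow> loglik \<rho> \<le> loglik \<pi>"
  by (auto simp: optimal_def is_arg_max_def not_less)

lemma L_small_outside_ball:
  assumes "0 < \<epsilon>"
  shows "\<exists>R>0. \<forall>i. \<forall>\<theta>. R \<le> norm \<theta> \<longrightarrow> L i \<theta> < \<epsilon>"
proof -
  have "\<forall>\<^sub>F \<theta> in at_infinity. \<forall>i. L i \<theta> < \<epsilon>"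
    using order_tendstoD(2)[OF L_vanish assms] by (simp add: eventually_all_finite)
  then obtain b where b: "\<And>\<theta> i. b \<le> norm \<theta> \<Longrightarrow> L i \<theta> < \<epsilon>"
    by (auto simp: eventually_at_infinity)
  show ?thesis
    by (intro exI[of _ "max b 1"]) (auto intro: b)
qed

lemma L_bounded_borel: "L i \<in> bounded_borel"
proof -
  obtain R where R: "\<forall>i. \<forall>\<theta>. R \<le> norm \<theta> \<longrightarrow> L i \<theta> < 1"
    using L_small_outside_ball[of 1] by auto
  have "compact (L i ` cball 0 R)"
    using L_cont by (intro compact_continuous_image continuous_on_subset[OF L_cont]) auto
  then obtain B where B: "\<forall>\<theta>\<in>cball 0 R. \<bar>L i \<theta>\<bar> \<le> B"
    by (auto simp: bounded_iff dest!: compact_imp_bounded)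
  show ?thesis
  proof (rule bounded_borelI)
    show "L i \<in> borel_measurable borel"
      by (rule borel_measurable_continuous_onI[OF L_cont])
    show "\<bar>L i \<theta>\<bar> \<le> max B 1" for \<theta>
    proof (cases "R \<le> norm \<theta>")
      case True
      then show ?thesis using R L_pos[of i \<theta>] by (simp add: le_max_iff_disj less_imp_le)
    next
      case False
      then have "\<theta> \<in> cball 0 R" by simp
      then show ?thesis using B by (simp add: le_max_iff_disj)
    qed
  qed
qed

lemma mix_pos:
  assumes "\<pi> \<in> space (prob_algebra borel)"
  shows "0 < mix \<pi> i"
proof -
  interpret prob_space \<pi> using assms by (simp add: space_prob_algebra)
  have "space \<pi> = UNIV" using assms by (auto simp: space_prob_algebra dest: sets_eq_imp_space_eq)
  then show ?thesis
    unfolding mix_def using emeasure_space_1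
    by (intro integral_pos_prob[OF assms L_bounded_borel]) (auto simp: L_pos less_imp_le)
qed

section \<open>Compactness of the likelihood vectors and existence of a maximiser\<close>

definition F :: "'a \<Rightarrow> real^'n" where
  "F \<theta> = (\<chi> i. L i \<theta>)"

definition mixvec :: "'a measure \<Rightarrow> real^'n" where
  "mixvec \<pi> = (\<chi> i. mix \<pi> i)"

lemma continuous_F: "continuous_on A F"
  unfolding F_def by (intro continuous_on_vec_lambda continuous_on_subset[OF L_cont]) auto

text \<open>Far away in \<open>\<theta>\<close> all likelihoods are small, so up to any small ball
  about 0 the range is the compact image of a ball. The bound per coordinate is divided by the
  number of coordinates because the norm is estimated by the sum of absolute values.\<close>

lemma range_F_subset:
  assumes "0 < \<epsilon>"
  shows "\<exists>R. insert 0 (range F) \<subseteq> F ` cball 0 R \<union> cball 0 \<epsilon>"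
proof -
  obtain R where R: "0 < R" "\<forall>i. \<forall>\<theta>. R \<le> norm \<theta> \<longrightarrow> L i \<theta> < \<epsilon> / CARD('n)"
    using L_small_outside_ball[of "\<epsilon> / CARD('n)"] assms by auto
  have "norm (F \<theta>) \<le> \<epsilon>" if "R \<le> norm \<theta>" for \<theta>
  proof -
    have "norm (F \<theta>) \<le> (\<Sum>i\<in>UNIV. \<bar>F \<theta> $ i\<bar>)"
      by (rule norm_le_l1_cart)
    also have "\<dots> \<le> (\<Sum>i\<in>(UNIV::'n set). \<epsilon> / CARD('n))"
      using R(2) that L_pos by (intro sum_mono) (simp add: F_def less_imp_le)
    also have "\<dots> = \<epsilon>" by simp
    finally show ?thesis .
  qed
  then have "F \<theta> \<in> F ` cball 0 R \<union> cball 0 \<epsilon>" for \<theta>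
    by (cases "R \<le> norm \<theta>") auto
  then have "range F \<subseteq> F ` cball 0 R \<union> cball 0 \<epsilon>" by blast
  then show ?thesis using assms by (intro exI[of _ R]) (simp add: insert_subset)
qed

lemma compact_insert_0_range_F: "compact (insert 0 (range F))"
  unfolding compact_eq_bounded_closed
proof
  obtain R where "insert 0 (range F) \<subseteq> F ` cball 0 R \<union> cball 0 1"
    using range_F_subset[of 1] by auto
  moreover have "bounded (F ` cball 0 R \<union> cball 0 1)"
    by (intro bounded_Un[THEN iffD2] conjI compact_imp_bounded compact_continuous_image continuous_F) auto
  ultimately show "bounded (insert 0 (range F))"
    using bounded_subset by blast
  show "closed (insert 0 (range F))"
  proof (rule closure_subset_eq[THEN iffD1], rule subsetI)
    fix y assume y: "y \<in> closure (insert 0 (range F))"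
    show "y \<in> insert 0 (range F)"
    proof (cases "y = 0")
      case False
      \<comment> \<open>With this radius \<open>y\<close> lies outside the ball about 0, so a limit
        point \<open>y\<close> has to lie in the compact image.\<close>
      then obtain R where R: "insert 0 (range F) \<subseteq> F ` cball 0 R \<union> cball 0 (norm y / 2)"
        using range_F_subset[of "norm y / 2"] by auto
      let ?C = "F ` cball 0 R \<union> cball 0 (norm y / 2)"
      have "closed ?C"
        by (intro closed_Un compact_imp_closed compact_continuous_image continuous_F) auto
      then have "y \<in> ?C"
        using y closure_minimal[OF R] by blast
      then show ?thesis using False by auto
    qed simp
  qed
qed

text \<open>A hyperplane strictly separating the mean vector from the closed hull would bound all
  likelihood vectors on one side; integrating that bound contradicts the separation.\<close>

lemma mixvec_in_hull:
  assumes "\<pi> \<in> space (prob_algebra borel)"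
  shows "mixvec \<pi> \<in> convex hull (insert 0 (range F))"
proof (rule ccontr)
  assume "\<not> ?thesis"
  moreover have "closed (convex hull (insert 0 (range F)))"
    by (intro compact_imp_closed compact_convex_hull compact_insert_0_range_F)
  ultimately obtain a b where ab: "a \<bullet> mixvec \<pi> < b"
    "\<And>x. x \<in> convex hull (insert 0 (range F)) \<Longrightarrow> b < a \<bullet> x"
    using separating_hyperplane_closed_point[OF convex_convex_hull] by blast
  interpret prob_space \<pi> using assms by (simp add: space_prob_algebra)
  have b: "b \<le> (\<Sum>i\<in>UNIV. a $ i * L i \<theta>)" for \<theta>
    using ab(2)[of "F \<theta>"] hull_inc[of "F \<theta>"] by (auto simp: F_def inner_vec_def)
  have "b = (LINT \<theta>|\<pi>. b)" by (simp add: prob_space)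
  also have "\<dots> \<le> (LINT \<theta>|\<pi>. (\<Sum>i\<in>UNIV. a $ i * L i \<theta>))"
    using b by (intro integral_mono integrable_bounded_borel[OF assms] bounded_borel_const
        bounded_borel_sum bounded_borel_cmult L_bounded_borel)
  also have "\<dots> = a \<bullet> mixvec \<pi>"
    by (subst Bochner_Integration.integral_sum)
      (auto simp: mixvec_def mix_def inner_vec_def intro!: integrable_bounded_borel[OF assms] L_bounded_borel)
  finally show False using ab(1) by simp
qed

text \<open>Point masses produce the likelihood vectors themselves, and mixing measures makes the
  set of mean vectors convex.\<close>

lemma hull_range_F_mixvec:
  "convex hull (range F) \<subseteq> mixvec ` space (prob_algebra borel)"
proof (rule hull_minimal)
  show "range F \<subseteq> mixvec ` space (prob_algebra borel)"
  proof safe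
    fix \<theta> :: 'a
    have "return borel \<theta> \<in> space (prob_algebra borel)"
      by (simp add: space_prob_algebra prob_space_return)
    moreover have "F \<theta> = mixvec (return borel \<theta>)"
      by (simp add: F_def mixvec_def mix_def vec_eq_iff integral_return L_bounded_borel[THEN bounded_borel_measurable])
    ultimately show "F \<theta> \<in> mixvec ` space (prob_algebra borel)" by blast
  qed
  show "convex (mixvec ` space (prob_algebra borel))"
    unfolding convex_alt
  proof safe
    fix \<pi>\<^sub>0 \<pi>\<^sub>1 :: "'a measure" and u :: real
    assume "\<pi>\<^sub>0 \<in> space (prob_algebra borel)" "\<pi>\<^sub>1 \<in> space (prob_algebra borel)" "0 \<le> u" "u \<le> 1"
    then obtain \<pi> :: "'a measure" where "\<pi> \<in> space (prob_algebra borel)"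
      "\<forall>f\<in>bounded_borel. (LINT x|\<pi>. f x) = (1 - u) * (LINT x|\<pi>\<^sub>0. f x) + u * (LINT x|\<pi>\<^sub>1. f x)"
      using prob_mixture_exists by blast
    then show "(1 - u) *\<^sub>R mixvec \<pi>\<^sub>0 + u *\<^sub>R mixvec \<pi>\<^sub>1 \<in> mixvec ` space (prob_algebra borel)"
      by (intro image_eqI[of _ _ \<pi>]) (auto simp: mixvec_def mix_def vec_eq_iff L_bounded_borel)
  qed
qed

lemma hull_nonneg: "x \<in> convex hull (insert 0 (range F)) \<Longrightarrow> 0 \<le> x $ i"
proof -
  assume "x \<in> convex hull (insert 0 (range F))"
  moreover have "convex hull (insert 0 (range F)) \<subseteq> {x. \<forall>i. 0 \<le> x $ i}"
    by (intro hull_minimal) (auto simp: F_def L_pos less_imp_le convex_def)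
  ultimately show ?thesis by auto
qed

text \<open>The product is continuous on the whole compact hull, including 0, where the sum of
  logarithms is not.\<close>

lemma loglik_eq_ln_prod:
  "\<pi> \<in> space (prob_algebra borel) \<Longrightarrow> loglik \<pi> = ln (\<Prod>i\<in>UNIV. mixvec \<pi> $ i)"
  unfolding loglik_def mixvec_def
  by (subst ln_prod) (auto simp: mix_pos less_imp_neq[symmetric] dest: mix_pos)

text \<open>Adding \<open>0\<close> to the range makes the convex hull compact; a maximiser of the product of the
  coordinates may put weight on \<open>0\<close>, but discarding that weight does not decrease the product.\<close>

lemma optimal_exists: "\<exists>\<pi>. optimal \<pi>"
proof -
  let ?H = "convex hull (insert 0 (range F))"
  let ?P = "\<lambda>x::real^'n. \<Prod>i\<in>UNIV. x $ i"
  have "\<exists>x\<in>?H. \<forall>y\<in>?H. ?P y \<le> ?P x"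
    by (intro continuous_attains_sup compact_convex_hull compact_insert_0_range_F continuous_intros) auto
  then obtain x where x: "x \<in> ?H" "\<And>y. y \<in> ?H \<Longrightarrow> ?P y \<le> ?P x" by blast
  obtain u v y where uv: "0 \<le> u" "0 \<le> v" "u + v = 1" and y: "y \<in> convex hull (range F)"
    and xy: "x = v *\<^sub>R y"
    using x(1) by (subst (asm) convex_hull_insert) auto
  have yH: "y \<in> ?H"
    using y hull_mono[of "range F" "insert 0 (range F)"] by auto
  have "?P x \<le> ?P y"
    using uv hull_nonneg[OF yH] unfolding xy by (intro prod_mono) (auto intro: mult_left_le_one_le)
  then have y_max: "?P z \<le> ?P y" if "z \<in> ?H" for z
    using x(2)[OF that] by simp
  obtain \<pi> where \<pi>: "\<pi> \<in> space (prob_algebra borel)" "y = mixvec \<pi>"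
    using y hull_range_F_mixvec by blast
  have "loglik \<rho> \<le> loglik \<pi>" if \<rho>: "\<rho> \<in> space (prob_algebra borel)" for \<rho>
    using y_max[OF mixvec_in_hull[OF \<rho>]] \<rho> \<pi>
    by (simp add: loglik_eq_ln_prod mixvec_def mix_pos prod_pos)
  then have "optimal \<pi>"
    using \<pi>(1) by (auto simp: optimal_def is_arg_max_def not_less)
  then show ?thesis ..
qed

end

section \<open>Auxiliary facts on the logarithm and on separated balls\<close>

lemma ln_midpoint_le:
  fixes a b :: real
  assumes "0 < a" "0 < b"
  shows "ln a + ln b \<le> 2 * ln ((a + b) / 2)"
    and "a \<noteq> b \<Longrightarrow> ln a + ln b < 2 * ln ((a + b) / 2)"
proof -
  \<comment> \<open>The arithmetic-geometric mean inequality with its defect made explicit, which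
    also yields the strict case.\<close>
  have sq: "((a + b) / 2)\<^sup>2 = a * b + ((a - b) / 2)\<^sup>2"
    by (simp add: field_simps power2_eq_square)
  have "2 * ln ((a + b) / 2) = ln (((a + b) / 2)\<^sup>2)"
    using assms by (simp add: ln_realpow)
  moreover have "ln a + ln b = ln (a * b)"
    using assms by (simp add: ln_mult)
  moreover have "0 < a * b" using assms by simp
  ultimately show "ln a + ln b \<le> 2 * ln ((a + b) / 2)"
    and "a \<noteq> b \<Longrightarrow> ln a + ln b < 2 * ln ((a + b) / 2)"
    unfolding sq by (auto simp: add_pos_nonneg)
qed

lemma finite_disjoint_balls:
  fixes T :: "'a::metric_space set"
  assumes "finite T"
  shows "\<exists>r>0. \<forall>s\<in>T. \<forall>t\<in>T. s \<noteq> t \<longrightarrow> ball s r \<inter> ball t r = {}"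
proof -
  have "\<exists>d>0. \<forall>t\<in>T. t \<noteq> s \<longrightarrow> d \<le> dist s t" for s
    using finite_set_avoid[OF assms] by blast
  then obtain d where d: "\<And>s. 0 < d s" "\<And>s t. t \<in> T \<Longrightarrow> t \<noteq> s \<Longrightarrow> d s \<le> dist s t"
    by metis
  \<comment> \<open>Half the smallest separation; the inserted 1 keeps the minimum meaningful for
    empty \<open>T\<close>.\<close>
  let ?r = "Min (insert 1 (d ` T)) / 2"
  have "0 < ?r" using d(1) assms by simp
  moreover have "ball s ?r \<inter> ball t ?r = {}" if "s \<in> T" "t \<in> T" "s \<noteq> t" for s t
  proof -
    have "2 * ?r \<le> d s" using that assms by (auto intro: Min_le)
    also have "\<dots> \<le> dist s t" using that d(2)[of t s] by auto
    finally show ?thesis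
      by (intro disjoint_ballI) simp
  qed
  ultimately show ?thesis by blast
qed

lemma sum_indicator_disjoint_balls:
  fixes a :: "'a::metric_space \<Rightarrow> real"
  assumes "finite T" "\<forall>s\<in>T. \<forall>t\<in>T. s \<noteq> t \<longrightarrow> ball s r \<inter> ball t r = {}" "s \<in> T" "x \<in> ball s r"
  shows "(\<Sum>t\<in>T. a t * indicator (ball t r) x) = a s"
proof -
  have "x \<notin> ball t r" if "t \<in> T" "t \<noteq> s" for t
    using assms that by blast
  then have "(\<Sum>t\<in>T. a t * indicator (ball t r) x) = (\<Sum>t\<in>T. if t = s then a s else 0)"
    using assms(4) by (intro sum.cong) (auto simp: indicator_def)
  then show ?thesis using assms by simp
qed

section \<open>Common mixture values, bounded support and perturbation of maximisers\<close>

context likelihood_family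
begin

lemma loglik_strict_mono:
  assumes "\<pi> \<in> space (prob_algebra borel)" "\<And>i. mix \<pi> i < mix \<rho> i"
  shows "loglik \<pi> < loglik \<rho>"
proof -
  have "0 < mix \<pi> i" "0 < mix \<rho> i" for i
    using mix_pos[OF assms(1), of i] assms(2)[of i] by auto
  then show ?thesis
    unfolding loglik_def using assms(2) by (intro sum_strict_mono) auto
qed

text \<open>The midpoint measure averages the mixture values. Concavity of the logarithm makes it a
  maximiser, and strict concavity would make it strictly better if some value differed.\<close>

lemma optimal_midpoint:
  assumes "optimal \<pi>\<^sub>0" "optimal \<pi>\<^sub>1"
  shows "mix \<pi>\<^sub>0 i = mix \<pi>\<^sub>1 i"
    and "\<exists>\<pi>. optimal \<pi> \<and> (\<forall>f\<in>bounded_borel. (LINT \<theta>|\<pi>. f \<theta>) = ((LINT \<theta>|\<pi>\<^sub>0. f \<theta>) + (LINT \<theta>|\<pi>\<^sub>1. f \<theta>)) / 2)"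
proof -
  note p = assms[THEN optimal_prob]
  obtain \<pi> :: "'a measure" where \<pi>: "\<pi> \<in> space (prob_algebra borel)"
    and "\<forall>f\<in>bounded_borel. (LINT x|\<pi>. f x) = (1 - 1/2) * (LINT x|\<pi>\<^sub>0. f x) + 1/2 * (LINT x|\<pi>\<^sub>1. f x)"
    using prob_mixture_exists[OF p, of "1/2"] by auto
  then have I: "\<forall>f\<in>bounded_borel. (LINT x|\<pi>. f x) = ((LINT x|\<pi>\<^sub>0. f x) + (LINT x|\<pi>\<^sub>1. f x)) / 2"
    by (simp add: field_simps)
  then have m: "mix \<pi> i = (mix \<pi>\<^sub>0 i + mix \<pi>\<^sub>1 i) / 2" for i
    by (simp add: mix_def L_bounded_borel)
  note pos = mix_pos[OF p(1)] mix_pos[OF p(2)]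
  have eq: "loglik \<pi>\<^sub>0 = loglik \<pi>\<^sub>1"
    using optimal_le[OF assms(1) p(2)] optimal_le[OF assms(2) p(1)] by simp
  have le: "loglik \<pi>\<^sub>0 + loglik \<pi>\<^sub>1 \<le> 2 * loglik \<pi>"
    unfolding loglik_def sum_distrib_left sum.distrib[symmetric] m
    by (intro sum_mono ln_midpoint_le pos)
  show "mix \<pi>\<^sub>0 i = mix \<pi>\<^sub>1 i"
  proof (rule ccontr)
    assume "mix \<pi>\<^sub>0 i \<noteq> mix \<pi>\<^sub>1 i"
    then have "loglik \<pi>\<^sub>0 + loglik \<pi>\<^sub>1 < 2 * loglik \<pi>"
      unfolding loglik_def sum_distrib_left sum.distrib[symmetric] m
      by (intro sum_strict_mono_ex1) (auto intro!: ln_midpoint_le pos bexI[of _ i])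
    then show False
      using optimal_le[OF assms(1) \<pi>] eq by simp
  qed
  have "optimal \<pi>"
    using \<pi> le eq optimal_le[OF assms(1)] unfolding optimal_def is_arg_max_def by fastforce
  then show "\<exists>\<pi>. optimal \<pi> \<and> (\<forall>f\<in>bounded_borel. (LINT \<theta>|\<pi>. f \<theta>) = ((LINT \<theta>|\<pi>\<^sub>0. f \<theta>) + (LINT \<theta>|\<pi>\<^sub>1. f \<theta>)) / 2)"
    using I by blast
qed

text \<open>Mass where every likelihood is below half its mixture value is better redistributed.\<close>

lemma optimal_bounded_support:
  assumes "optimal \<pi>"
  shows "\<exists>R>0. AE \<theta> in \<pi>. \<theta> \<in> cball 0 R"
proof -
  note \<pi> = optimal_prob[OF assms]
  interpret prob_space \<pi> using \<pi> by (simp add: space_prob_algebra)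
  have sets: "sets \<pi> = sets borel" using \<pi> by (simp add: space_prob_algebra)
  have space: "space \<pi> = UNIV" using sets_eq_imp_space_eq[OF sets] by simp
  define \<epsilon> where "\<epsilon> = Min (range (mix \<pi>)) / 2"
  have "0 < \<epsilon>" using mix_pos[OF \<pi>] by (simp add: \<epsilon>_def)
  have \<epsilon>: "\<epsilon> \<le> mix \<pi> i / 2" for i by (simp add: \<epsilon>_def)
  obtain R where R: "0 < R" "\<And>i \<theta>. R \<le> norm \<theta> \<Longrightarrow> L i \<theta> < \<epsilon>"
    using L_small_outside_ball[OF \<open>0 < \<epsilon>\<close>] by auto
  let ?C = "cball 0 R :: 'a set"
  have ind: "indicator ?C \<in> bounded_borel"
    by (intro bounded_borel_indicator) simp
  define c where "c = prob ?C"
  have c: "(LINT \<theta>|\<pi>. indicator ?C \<theta>) = c"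
    by (simp add: c_def space)
  \<comment> \<open>Outside the ball the likelihood is below half the mixture value, so the outer
    mass \<open>1 - c\<close> accounts for at most the fraction \<open>(1 - c) / 2\<close> of
    it.\<close>
  have lower: "mix \<pi> i * (1 - (1 - c) / 2) \<le> (LINT \<theta>|\<pi>. indicator ?C \<theta> * L i \<theta>)" for i
  proof -
    have "mix \<pi> i = (LINT \<theta>|\<pi>. L i \<theta>)" by (simp add: mix_def)
    also have "\<dots> \<le> (LINT \<theta>|\<pi>. indicator ?C \<theta> * L i \<theta> + mix \<pi> i / 2 * (1 + - 1 * indicator ?C \<theta>))"
    proof (intro integral_mono integrable_bounded_borel[OF \<pi>])
      show "(\<lambda>\<theta>. indicator ?C \<theta> * L i \<theta> + mix \<pi> i / 2 * (1 + - 1 * indicator ?C \<theta>)) \<in> bounded_borel"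
        by (intro bounded_borel_add bounded_borel_mult bounded_borel_const ind L_bounded_borel)
      show "L i \<theta> \<le> indicator ?C \<theta> * L i \<theta> + mix \<pi> i / 2 * (1 + - 1 * indicator ?C \<theta>)" for \<theta>
        using R(2)[of \<theta> i] \<epsilon>[of i] by (auto simp: indicator_def)
    qed (rule L_bounded_borel)
    also have "\<dots> = (LINT \<theta>|\<pi>. indicator ?C \<theta> * L i \<theta>) + mix \<pi> i / 2 * (1 + - 1 * c)"
      by (subst Bochner_Integration.integral_add)
        (auto intro!: integrable_bounded_borel[OF \<pi>] bounded_borel_mult ind L_bounded_borel bounded_borel_cmult
          bounded_borel_add bounded_borel_const bounded_borel_indicator
          simp: Bochner_Integration.integral_diff prob_space[unfolded space] c_def space integrable_bounded_borel[OF \<pi> ind])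
    finally show ?thesis by (simp add: field_simps)
  qed
  have c01: "0 \<le> c" "c \<le> 1" by (auto simp: c_def)
  have "c \<noteq> 0"
  proof
    assume "c = 0"
    then have "?C \<in> null_sets \<pi>"
      by (simp add: c_def null_sets_def sets emeasure_eq_measure)
    then have "AE \<theta> in \<pi>. \<theta> \<notin> ?C"
      by (rule AE_not_in)
    then have "(LINT \<theta>|\<pi>. indicator ?C \<theta> * L i \<theta>) = 0" for i
      by (intro integral_eq_zero_AE) (auto elim!: eventually_mono)
    then show False
      using lower[of undefined] mix_pos[OF \<pi>, of undefined] \<open>c = 0\<close> by simp
  qed
  then have "0 < c" using c01 by simp
  then obtain \<rho> where \<rho>: "\<rho> \<in> space (prob_algebra borel)" and
    I: "\<And>f. f \<in> bounded_borel \<Longrightarrow> (LINT x|\<rho>. f x) = (LINT x|\<pi>. indicator ?C x * f x) / c"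
    using prob_reweight[OF \<pi> ind] c by auto
  have "c = 1"
  proof (rule ccontr)
    assume "c \<noteq> 1"
    then have "c < 1" using c01 by simp
    have "mix \<pi> i < mix \<rho> i" for i
    proof -
      \<comment> \<open>The factor on the right is \<open>(1 + c) / 2\<close>, which exceeds
        \<open>c\<close>: conditioning on the ball raises every mixture value strictly.\<close>
      have "c * mix \<pi> i < mix \<pi> i * (1 - (1 - c) / 2)"
        using \<open>c < 1\<close> mix_pos[OF \<pi>, of i] by (simp add: field_simps)
      also note lower[of i]
      also have "(LINT \<theta>|\<pi>. indicator ?C \<theta> * L i \<theta>) = c * mix \<rho> i"
        using I[OF L_bounded_borel] \<open>0 < c\<close> by (simp add: mix_def)
      finally show ?thesis using \<open>0 < c\<close> by simp
    qed
    then have "loglik \<pi> < loglik \<rho>" by (rule loglik_strict_mono[OF \<pi>])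
    then show False using optimal_le[OF assms \<rho>] by simp
  qed
  then have "AE \<theta> in \<pi>. \<theta> \<in> ?C"
    unfolding c_def by (rule AE_prob_1)
  then show ?thesis using R(1) by blast
qed

text \<open>The directions \<open>g\<close> for which reweighting \<open>\<pi>\<close> by
  \<open>1 + g\<close> leaves all mixture values unchanged; membership amounts to one linear
  condition per observation.\<close>

definition ker :: "'a measure \<Rightarrow> ('a \<Rightarrow> real) set" where
  "ker \<pi> = {g \<in> bounded_borel. \<forall>i. (LINT \<theta>|\<pi>. g \<theta> * L i \<theta>) = 0}"

lemma ker_bounded: "g \<in> ker \<pi> \<Longrightarrow> g \<in> bounded_borel"
  by (simp add: ker_def)

lemma ker_integral: "g \<in> ker \<pi> \<Longrightarrow> (LINT \<theta>|\<pi>. g \<theta> * L i \<theta>) = 0"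
  by (simp add: ker_def)

lemma ker_cmult: "g \<in> ker \<pi> \<Longrightarrow> (\<lambda>\<theta>. c * g \<theta>) \<in> ker \<pi>"
  by (simp add: ker_def bounded_borel_cmult mult.assoc)

lemma ker_add:
  assumes "\<pi> \<in> space (prob_algebra borel)" "g \<in> ker \<pi>" "h \<in> ker \<pi>"
  shows "(\<lambda>\<theta>. g \<theta> + h \<theta>) \<in> ker \<pi>"
  using assms unfolding ker_def
  by (auto simp: distrib_right bounded_borel_add bounded_borel_mult L_bounded_borel
      Bochner_Integration.integral_add integrable_bounded_borel)

lemma ker_sum:
  assumes "\<pi> \<in> space (prob_algebra borel)" "\<And>j. j \<in> J \<Longrightarrow> g j \<in> ker \<pi>"
  shows "(\<lambda>\<theta>. \<Sum>j\<in>J. g j \<theta>) \<in> ker \<pi>"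
  using assms(2)
proof (induction J rule: infinite_finite_induct)
  case (insert j J)
  then show ?case using ker_add[OF assms(1), of "g j"] by simp
qed (auto simp: ker_def bounded_borel_const)

text \<open>Perturbing an optimal \<open>\<pi>\<close> to \<open>(1 \<plusminus> g) \<pi>\<close> and renormalising scales all mixture values by the
  same factor; optimality in both directions forces that factor to be 1.\<close>

lemma ker_perturb:
  assumes "optimal \<pi>" "g \<in> ker \<pi>" "\<And>\<theta>. \<bar>g \<theta>\<bar> \<le> 1/2"
  shows "\<exists>\<rho>. optimal \<rho> \<and> (\<forall>f\<in>bounded_borel. (LINT \<theta>|\<rho>. f \<theta>) = (LINT \<theta>|\<pi>. (1 + g \<theta>) * f \<theta>))"
proof -
  note \<pi> = optimal_prob[OF assms(1)]
  interpret prob_space \<pi> using \<pi> by (simp add: space_prob_algebra)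
  have step: "\<exists>\<rho>. \<rho> \<in> space (prob_algebra borel) \<and> 0 \<le> (LINT \<theta>|\<pi>. g \<theta>) \<and> loglik \<rho> = loglik \<pi> - CARD('n) * ln (1 + (LINT \<theta>|\<pi>. g \<theta>)) \<and>
     (\<forall>f\<in>bounded_borel. (LINT \<theta>|\<rho>. f \<theta>) = (LINT \<theta>|\<pi>. (1 + g \<theta>) * f \<theta>) / (1 + (LINT \<theta>|\<pi>. g \<theta>)))"
    if g: "g \<in> ker \<pi>" "\<And>\<theta>. \<bar>g \<theta>\<bar> \<le> 1/2" for g
  proof -
    let ?h = "\<lambda>\<theta>. 1 + g \<theta>"
    let ?m = "LINT \<theta>|\<pi>. g \<theta>"
    have gi: "integrable \<pi> g"
      using g ker_bounded integrable_bounded_borel[OF \<pi>] by blast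
    have h: "?h \<in> bounded_borel" "0 \<le> ?h \<theta>" for \<theta>
      using ker_bounded[OF g(1)] abs_le_D2[OF g(2)[of \<theta>]]
      by (auto intro: bounded_borel_add bounded_borel_const)
    have c: "(LINT \<theta>|\<pi>. ?h \<theta>) = 1 + ?m"
      using gi by (simp add: prob_space)
    have "-1/2 = (LINT \<theta>|\<pi>. -1/2 :: real)" by (simp add: prob_space)
    also have "\<dots> \<le> ?m"
      using abs_le_D2[OF g(2)] gi by (intro integral_mono) (auto simp: field_simps)
    finally have m: "0 < 1 + ?m" by simp
    then obtain \<rho> where \<rho>: "\<rho> \<in> space (prob_algebra borel)"
      "\<forall>f\<in>bounded_borel. (LINT \<theta>|\<rho>. f \<theta>) = (LINT \<theta>|\<pi>. (1 + g \<theta>) * f \<theta>) / (1 + ?m)"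
      using prob_reweight[OF \<pi> h] c by auto
    have "(LINT \<theta>|\<pi>. (1 + g \<theta>) * L i \<theta>) = mix \<pi> i" for i
      using ker_integral[OF g(1)] ker_bounded[OF g(1)]
      by (simp add: distrib_right mix_def integrable_bounded_borel[OF \<pi>] L_bounded_borel bounded_borel_mult)
    then have "mix \<rho> i = mix \<pi> i / (1 + ?m)" for i
      using \<rho>(2) by (simp add: mix_def L_bounded_borel)
    then have l: "loglik \<rho> = loglik \<pi> - CARD('n) * ln (1 + ?m)"
      using m by (simp add: loglik_def ln_div sum_subtractf mix_pos[OF \<pi>, THEN less_imp_neq, symmetric])
    then have "0 \<le> ln (1 + ?m)"
      using optimal_le[OF assms(1) \<rho>(1)] by (simp add: zero_le_mult_iff)
    then have "0 \<le> ?m"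
      using m by (simp add: ln_ge_zero_iff)
    with \<rho> l show ?thesis by blast
  qed
  obtain \<rho> where \<rho>: "\<rho> \<in> space (prob_algebra borel)" "0 \<le> (LINT \<theta>|\<pi>. g \<theta>)"
    "loglik \<rho> = loglik \<pi> - CARD('n) * ln (1 + (LINT \<theta>|\<pi>. g \<theta>))"
     "\<forall>f\<in>bounded_borel. (LINT \<theta>|\<rho>. f \<theta>) = (LINT \<theta>|\<pi>. (1 + g \<theta>) * f \<theta>) / (1 + (LINT \<theta>|\<pi>. g \<theta>))"
    using step[OF assms(2,3)] by auto
  have "(LINT \<theta>|\<pi>. - g \<theta>) \<ge> 0"
    using step[of "\<lambda>\<theta>. - g \<theta>"] ker_cmult[OF assms(2), of "-1"] assms(3) by auto
  then have "(LINT \<theta>|\<pi>. g \<theta>) = 0" using \<rho>(2) by simp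
  with \<rho> assms(1) show ?thesis
    by (intro exI[of _ \<rho>]) (auto simp: optimal_def is_arg_max_def)
qed

end

section \<open>Support size and uniqueness from agreement of moments\<close>

context likelihood_family
begin

text \<open>The integrands are truncated to a ball containing the supports to keep them bounded.\<close>

definition moments_agree :: bool where
  "moments_agree \<longleftrightarrow> (\<forall>\<pi>\<^sub>0 \<pi>\<^sub>1 R. optimal \<pi>\<^sub>0 \<longrightarrow> optimal \<pi>\<^sub>1 \<longrightarrow>
     (AE \<theta> in \<pi>\<^sub>0. \<theta> \<in> cball 0 R) \<longrightarrow> (AE \<theta> in \<pi>\<^sub>1. \<theta> \<in> cball 0 R) \<longrightarrow>
     (\<forall>i. \<forall>e\<in>Basis. (LINT \<theta>|\<pi>\<^sub>0. indicator (cball 0 R) \<theta> * (\<theta> \<bullet> e) * L i \<theta>)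
                    = (LINT \<theta>|\<pi>\<^sub>1. indicator (cball 0 R) \<theta> * (\<theta> \<bullet> e) * L i \<theta>)))"

text \<open>Lets almost sure statements pass between measures that are related only through
  integrals of bounded functions.\<close>

lemma AE_iff_integral_indicator:
  assumes "\<pi> \<in> space (prob_algebra borel)" "A \<in> sets borel"
  shows "(AE \<theta> in \<pi>. \<theta> \<in> A) \<longleftrightarrow> (LINT \<theta>|\<pi>. indicator (- A) \<theta>) = (0::real)"
proof -
  interpret prob_space \<pi> using assms by (simp add: space_prob_algebra)
  have sets: "sets \<pi> = sets borel" using assms by (simp add: space_prob_algebra)
  have space: "space \<pi> = UNIV" using sets_eq_imp_space_eq[OF sets] by simp
  have "(LINT \<theta>|\<pi>. indicator (- A) \<theta>) = prob (- A)"
    by (simp add: space)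
  moreover have "(AE \<theta> in \<pi>. \<theta> \<in> A) \<longleftrightarrow> emeasure \<pi> (- A) = 0"
    using assms(2) by (subst AE_iff_measurable[OF _ refl]) (auto simp: sets space Compl_eq)
  ultimately show ?thesis
    by (simp add: emeasure_eq_measure)
qed

context
  fixes \<pi> R
  assumes opt: "optimal \<pi>" and agree: "moments_agree"
    and R: "AE \<theta> in \<pi>. \<theta> \<in> cball 0 R"
begin

lemma prob_of_opt: "\<pi> \<in> space (prob_algebra borel)"
  by (rule optimal_prob[OF opt])

lemma integral_truncate:
  fixes f :: "'a \<Rightarrow> real"
  assumes "f \<in> borel_measurable borel"
  shows "(LINT \<theta>|\<pi>. indicator (cball 0 R) \<theta> * f \<theta>) = (LINT \<theta>|\<pi>. f \<theta>)"
proof -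
  have sets: "sets \<pi> = sets borel" using prob_of_opt by (simp add: space_prob_algebra)
  show ?thesis
  proof (rule integral_cong_AE)
    show "(\<lambda>\<theta>. indicator (cball 0 R) \<theta> * f \<theta>) \<in> borel_measurable \<pi>" "f \<in> borel_measurable \<pi>"
      using assms borel_measurable_times[OF borel_measurable_indicator assms, of "cball 0 R"]
      by (simp_all add: measurable_cong_sets[OF sets refl])
    show "AE \<theta> in \<pi>. indicator (cball 0 R) \<theta> * f \<theta> = f \<theta>"
      using R by eventually_elim simp
  qed
qed

lemma ker_truncate:
  assumes "g \<in> ker \<pi>"
  shows "(\<lambda>\<theta>. indicator (cball 0 R) \<theta> * g \<theta>) \<in> ker \<pi>"
proof -
  note gb = ker_bounded[OF assms]
  have "(LINT \<theta>|\<pi>. indicator (cball 0 R) \<theta> * g \<theta> * L i \<theta>) = 0" for i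
    using integral_truncate[OF bounded_borel_measurable, OF bounded_borel_mult[OF gb L_bounded_borel]]
      ker_integral[OF assms] by (simp add: mult.assoc)
  then show ?thesis
    using gb by (auto simp: ker_def bounded_borel_mult bounded_borel_indicator)
qed

lemma bounded_borel_coordinate:
  fixes e :: 'a
  shows "(\<lambda>\<theta>. indicator (cball 0 R) \<theta> * (\<theta> \<bullet> e)) \<in> bounded_borel"
  by (rule bounded_borel_continuous_compact[where f="\<lambda>\<theta>. \<theta> \<bullet> e"]) (auto intro: continuous_intros)

text \<open>A small multiple \<open>h\<close> of \<open>g\<close> turns \<open>\<pi>\<close> into
  another maximiser carried by the same ball. Its weighted moments equal those of
  \<open>\<pi>\<close>, and the difference of the two is the integral of \<open>h\<close> times the
  coordinate times the likelihood.\<close>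

lemma ker_coordinate:
  assumes "g \<in> ker \<pi>" "e \<in> Basis"
  shows "(\<lambda>\<theta>. indicator (cball 0 R) \<theta> * (\<theta> \<bullet> e) * g \<theta>) \<in> ker \<pi>"
proof -
  obtain B where B: "0 < B" "\<And>\<theta>. \<bar>g \<theta>\<bar> \<le> B"
    using bounded_borel_bound[OF ker_bounded[OF assms(1)]] by auto
  \<comment> \<open>Scaled to meet the bound 1/2 of \<open>ker_perturb\<close>, which keeps
    \<open>1 + h\<close> positive.\<close>
  define h where "h = (\<lambda>\<theta>. 1 / (2 * B) * g \<theta>)"
  have hk: "h \<in> ker \<pi>" unfolding h_def by (rule ker_cmult[OF assms(1)])
  have "\<bar>h \<theta>\<bar> \<le> 1/2" for \<theta>
    using B by (simp add: h_def abs_mult field_simps)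
  then obtain \<rho> where \<rho>: "optimal \<rho>"
    and I: "\<And>f. f \<in> bounded_borel \<Longrightarrow> (LINT \<theta>|\<rho>. f \<theta>) = (LINT \<theta>|\<pi>. (1 + h \<theta>) * f \<theta>)"
    using ker_perturb[OF opt hk] by auto
  have "(LINT \<theta>|\<rho>. indicator (- cball 0 R) \<theta>) = (LINT \<theta>|\<pi>. (1 + h \<theta>) * indicator (- cball 0 R) \<theta>)"
    by (intro I bounded_borel_indicator) auto
  also have "\<dots> = 0"
    using R by (intro integral_eq_zero_AE) (auto elim!: eventually_mono)
  finally have "AE \<theta> in \<rho>. \<theta> \<in> cball 0 R"
    using AE_iff_integral_indicator[OF optimal_prob[OF \<rho>], of "cball 0 R"] by simp
  then have *: "(LINT \<theta>|\<pi>. indicator (cball 0 R) \<theta> * (\<theta> \<bullet> e) * L i \<theta>)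
             = (LINT \<theta>|\<rho>. indicator (cball 0 R) \<theta> * (\<theta> \<bullet> e) * L i \<theta>)" for i
    using agree opt \<rho> R assms(2) unfolding moments_agree_def by blast
  let ?f = "\<lambda>i \<theta>. indicator (cball 0 R) \<theta> * (\<theta> \<bullet> e) * L i \<theta>"
  have f: "?f i \<in> bounded_borel" for i
    by (intro bounded_borel_mult bounded_borel_coordinate L_bounded_borel)
  have "(LINT \<theta>|\<pi>. h \<theta> * ?f i \<theta>) = 0" for i
  proof -
    have "(LINT \<theta>|\<pi>. ?f i \<theta>) = (LINT \<theta>|\<pi>. ?f i \<theta> + h \<theta> * ?f i \<theta>)"
      unfolding * I[OF f] by (simp add: distrib_right)
    also have "\<dots> = (LINT \<theta>|\<pi>. ?f i \<theta>) + (LINT \<theta>|\<pi>. h \<theta> * ?f i \<theta>)"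
      by (intro Bochner_Integration.integral_add integrable_bounded_borel[OF prob_of_opt] f bounded_borel_mult ker_bounded[OF hk])
    finally show ?thesis by simp
  qed
  then have "(LINT \<theta>|\<pi>. indicator (cball 0 R) \<theta> * (\<theta> \<bullet> e) * g \<theta> * L i \<theta>) = 0" for i
    using B(1) by (simp add: h_def mult_ac)
  then show ?thesis
    using assms(1) by (auto simp: ker_def bounded_borel_mult bounded_borel_coordinate)
qed

text \<open>Induction with \<open>g\<close> arbitrary, since for a product the claim for
  \<open>f\<close> is applied to the element of \<open>ker \<pi>\<close> obtained from
  \<open>h\<close> and \<open>g\<close>. Linear functionals reduce to the coordinates.\<close>

lemma ker_polynomial:
  assumes "real_polynomial_function p" "g \<in> ker \<pi>"
  shows "(\<lambda>\<theta>. indicator (cball 0 R) \<theta> * (p \<theta> * g \<theta>)) \<in> ker \<pi>"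
  using assms
proof (induction p arbitrary: g rule: real_polynomial_function.induct)
  case (linear f)
  have feq: "f \<theta> = (\<Sum>e\<in>Basis. (\<theta> \<bullet> e) * f e)" for \<theta>
  proof -
    interpret f: bounded_linear f by fact
    have "f \<theta> = f (\<Sum>e\<in>Basis. (\<theta> \<bullet> e) *\<^sub>R e)" by (simp only: euclidean_representation)
    also have "\<dots> = (\<Sum>e\<in>Basis. (\<theta> \<bullet> e) * f e)" by (simp only: f.sum f.scaleR real_scaleR_def)
    finally show ?thesis .
  qed
  have "indicator (cball 0 R) \<theta> * (f \<theta> * g \<theta>)
    = (\<Sum>e\<in>Basis. f e * (indicator (cball 0 R) \<theta> * (\<theta> \<bullet> e) * g \<theta>))" for \<theta>
    by (subst feq) (simp add: sum_distrib_left sum_distrib_right mult_ac)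
  then show ?case
    using linear(2) by (simp add: ker_sum[OF prob_of_opt] ker_cmult ker_coordinate)
next
  case (const c)
  then show ?case by (intro ker_truncate ker_cmult)
next
  case (add f h)
  then show ?case
    using ker_add[OF prob_of_opt add.IH(1)[OF add.prems] add.IH(2)[OF add.prems]]
    by (simp add: algebra_simps)
next
  case (mult f h)
  have "indicator (cball 0 R) \<theta> * (f \<theta> * (indicator (cball 0 R) \<theta> * (h \<theta> * g \<theta>)))
    = indicator (cball 0 R) \<theta> * (f \<theta> * h \<theta> * g \<theta>)" for \<theta>
    by (simp add: indicator_def)
  then show ?case
    using mult.IH(1)[OF mult.IH(2)[OF mult.prems]] by (simp only:)
qed

text \<open>Stone-Weierstrass on the ball: the integral vanishes for polynomials, and uniform
  approximation within \<open>\<epsilon> / B\<close> against a factor bounded by \<open>B\<close>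
  changes it by at most \<open>\<epsilon>\<close>.\<close>

lemma ker_continuous:
  assumes "continuous_on UNIV f" "g \<in> ker \<pi>"
  shows "(LINT \<theta>|\<pi>. indicator (cball 0 R) \<theta> * f \<theta> * (g \<theta> * L i \<theta>)) = 0"
proof -
  interpret prob_space \<pi> using prob_of_opt by (simp add: space_prob_algebra)
  have gL: "(\<lambda>\<theta>. g \<theta> * L i \<theta>) \<in> bounded_borel"
    by (intro bounded_borel_mult ker_bounded[OF assms(2)] L_bounded_borel)
  obtain B where B: "0 < B" "\<And>\<theta>. \<bar>g \<theta> * L i \<theta>\<bar> \<le> B"
    using bounded_borel_bound[OF gL] by auto
  define H where "H q \<theta> = indicator (cball 0 R) \<theta> * q \<theta> * (g \<theta> * L i \<theta>)" for q and \<theta> :: 'a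
  have Hi: "integrable \<pi> (H q)" if "continuous_on UNIV q" for q
    using bounded_borel_mult[OF bounded_borel_continuous_compact[OF that compact_cball] gL]
    unfolding H_def by (rule integrable_bounded_borel[OF prob_of_opt])
  have "\<bar>LINT \<theta>|\<pi>. H f \<theta>\<bar> \<le> 0 + \<epsilon>" if eps: "0 < \<epsilon>" for \<epsilon>
  proof -
    obtain p where p: "real_polynomial_function p" "\<And>x. x \<in> cball 0 R \<Longrightarrow> \<bar>f x - p x\<bar> < \<epsilon> / B"
      by (rule Stone_Weierstrass_real_polynomial_function[of "cball 0 R" f "\<epsilon> / B"])
        (use assms(1) eps B(1) in \<open>auto intro: continuous_on_subset\<close>)
    have pc: "continuous_on UNIV p"
      using p(1) continuous_on_polymonial_function[of p] by (simp add: real_polynomial_function_eq)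
    have "(LINT \<theta>|\<pi>. H p \<theta>) = 0"
      using ker_integral[OF ker_polynomial[OF p(1) assms(2)]] by (simp add: H_def mult_ac)
    then have "(LINT \<theta>|\<pi>. H f \<theta>) = (LINT \<theta>|\<pi>. H f \<theta> - H p \<theta>)"
      by (simp add: Hi assms(1) pc)
    also have "\<bar>\<dots>\<bar> \<le> (LINT \<theta>|\<pi>. \<bar>H f \<theta> - H p \<theta>\<bar>)"
      by (rule integral_abs_bound)
    also have "\<dots> \<le> (LINT \<theta>|\<pi>. \<epsilon>)"
    proof (rule integral_mono)
      show "integrable \<pi> (\<lambda>\<theta>. \<bar>H f \<theta> - H p \<theta>\<bar>)"
        by (simp add: Hi assms(1) pc)
      fix \<theta>
      have "\<bar>H f \<theta> - H p \<theta>\<bar> = indicator (cball 0 R) \<theta> * \<bar>f \<theta> - p \<theta>\<bar> * \<bar>g \<theta> * L i \<theta>\<bar>"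
        unfolding H_def abs_mult[symmetric] by (simp add: indicator_def left_diff_distrib[symmetric] abs_mult)
      also have "\<dots> \<le> \<epsilon> / B * B"
        using p(2)[of \<theta>] B eps by (intro mult_mono) (auto simp: indicator_def less_imp_le)
      finally show "\<bar>H f \<theta> - H p \<theta>\<bar> \<le> \<epsilon>"
        using B(1) by simp
    qed simp
    also have "\<dots> = \<epsilon>" by (simp add: prob_space)
    finally show ?thesis by simp
  qed
  then have "\<bar>LINT \<theta>|\<pi>. H f \<theta>\<bar> \<le> 0"
    by (rule field_le_epsilon)
  then show ?thesis by (simp add: H_def)
qed

text \<open>Testing \<open>g\<close> against a tent function that is positive exactly on the ball
  gives 0 on one side and \<open>c\<close> times an integral on the other; that integral is positive
  because the centre is a support point.\<close>

lemma ker_const_on_ball: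
  assumes "g \<in> ker \<pi>" "0 < r" "\<And>\<theta>. \<theta> \<in> ball s r \<Longrightarrow> g \<theta> = c" "s \<in> topological_support \<pi>"
  shows "c = 0"
proof -
  \<comment> \<open>An arbitrary index serves, as every likelihood is positive.\<close>
  let ?i = "undefined :: 'n"
  let ?f = "\<lambda>\<theta>. max 0 (r - dist s \<theta>)"
  have f: "?f \<in> bounded_borel" "continuous_on UNIV ?f"
    using assms(2) by (auto intro!: bounded_borelI[where B=r] borel_measurable_continuous_onI continuous_intros)
  have fL: "(\<lambda>\<theta>. ?f \<theta> * L ?i \<theta>) \<in> bounded_borel"
    by (intro bounded_borel_mult f L_bounded_borel)
  have "{\<theta>. 0 < ?f \<theta> * L ?i \<theta>} = ball s r"
    using L_pos by (auto simp: zero_less_mult_iff less_max_iff_disj not_less less_imp_le[OF L_pos])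
  then have pos: "0 < (LINT \<theta>|\<pi>. ?f \<theta> * L ?i \<theta>)"
    using assms(2,4) L_pos by (intro integral_pos_prob[OF prob_of_opt fL])
      (auto simp: less_imp_le topological_support_def dest: spec[of _ "ball s r"])
  have eq: "?f \<theta> * (g \<theta> * L ?i \<theta>) = c * (?f \<theta> * L ?i \<theta>)" for \<theta>
    using assms(3)[of \<theta>] by (auto simp: max_def)
  have "0 = (LINT \<theta>|\<pi>. indicator (cball 0 R) \<theta> * ?f \<theta> * (g \<theta> * L ?i \<theta>))"
    using ker_continuous[OF f(2) assms(1)] by simp
  also have "\<dots> = (LINT \<theta>|\<pi>. indicator (cball 0 R) \<theta> * (c * (?f \<theta> * L ?i \<theta>)))"
    unfolding mult.assoc eq ..
  also have "\<dots> = c * (LINT \<theta>|\<pi>. ?f \<theta> * L ?i \<theta>)"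
    by (subst integral_truncate) (auto intro: bounded_borel_measurable[OF bounded_borel_cmult[OF fL]])
  finally show "c = 0" using pos by simp
qed

text \<open>With more than \<open>CARD('n)\<close> support points, a nonzero combination of
  indicators of disjoint balls around them satisfies the \<open>CARD('n)\<close> linear conditions
  of \<open>ker \<pi>\<close>. It is constant on each ball, so all its coefficients vanish, a
  contradiction.\<close>

lemma card_support_le:
  shows "finite (topological_support \<pi>)" and "card (topological_support \<pi>) \<le> CARD('n)"
proof -
  have False if T: "finite T" "T \<subseteq> topological_support \<pi>" "CARD('n) < card T" for T
  proof -
    obtain r where r: "0 < r" "\<forall>s\<in>T. \<forall>t\<in>T. s \<noteq> t \<longrightarrow> ball s r \<inter> ball t r = {}"
      using finite_disjoint_balls[OF T(1)] by auto
    define v :: "'a \<Rightarrow> real^'n" where "v s = (\<chi> i. LINT \<theta>|\<pi>. indicator (ball s r) \<theta> * L i \<theta>)" for s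
    obtain a where a: "\<exists>s\<in>T. a s \<noteq> 0" "(\<Sum>s\<in>T. a s *\<^sub>R v s) = 0"
      using nontrivial_linear_relation[OF T(1), of v] T(3) by auto
    let ?g = "\<lambda>\<theta>. \<Sum>s\<in>T. a s * indicator (ball s r) \<theta>"
    have "(LINT \<theta>|\<pi>. ?g \<theta> * L i \<theta>) = (\<Sum>s\<in>T. a s *\<^sub>R v s) $ i" for i
      by (simp add: sum_distrib_right v_def mult.assoc Bochner_Integration.integral_sum
          integrable_bounded_borel[OF prob_of_opt] bounded_borel_mult bounded_borel_indicator L_bounded_borel)
    then have g: "?g \<in> ker \<pi>"
      unfolding ker_def using a(2)
      by (auto intro!: bounded_borel_sum bounded_borel_cmult bounded_borel_indicator)
    have "a s = 0" if "s \<in> T" for s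
    proof (rule ker_const_on_ball[OF g r(1)])
      show "?g \<theta> = a s" if "\<theta> \<in> ball s r" for \<theta>
        using sum_indicator_disjoint_balls[OF T(1) r(2) \<open>s \<in> T\<close> that] .
    qed (use that T in auto)
    then show False using a(1) by blast
  qed
  then show fin: "finite (topological_support \<pi>)"
    by (metis infinite_arbitrarily_large lessI)
  then show "card (topological_support \<pi>) \<le> CARD('n)"
    using \<open>\<And>T. finite T \<Longrightarrow> T \<subseteq> topological_support \<pi> \<Longrightarrow> CARD('n) < card T \<Longrightarrow> False\<close> not_le by blast
qed

end

text \<open>Both maximisers are carried by the finite support of their midpoint
  \<open>\<pi>\<close>. The difference of their densities with respect to \<open>\<pi>\<close> lies
  in \<open>ker \<pi>\<close>, because their mixture values agree, and therefore vanishes at every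
  support point.\<close>

lemma optimal_unique:
  assumes agree: "moments_agree" and opt: "optimal \<pi>\<^sub>0" "optimal \<pi>\<^sub>1"
  shows "\<pi>\<^sub>0 = \<pi>\<^sub>1"
proof -
  obtain \<pi> where \<pi>: "optimal \<pi>" and
    I: "\<And>f. f \<in> bounded_borel \<Longrightarrow> (LINT \<theta>|\<pi>. f \<theta>) = ((LINT \<theta>|\<pi>\<^sub>0. f \<theta>) + (LINT \<theta>|\<pi>\<^sub>1. f \<theta>)) / 2"
    using optimal_midpoint(2)[OF opt] by blast
  obtain R where R: "AE \<theta> in \<pi>. \<theta> \<in> cball 0 R"
    using optimal_bounded_support[OF \<pi>] by auto
  define S where "S = topological_support \<pi>"
  have S: "finite S" unfolding S_def by (rule card_support_le[OF \<pi> agree R])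
  then have Sb: "S \<in> sets borel" by (simp add: borel_closed finite_imp_closed)
  note pr = optimal_prob[OF \<pi>] optimal_prob[OF opt(1)] optimal_prob[OF opt(2)]
  have AE: "AE \<theta> in \<pi>. \<theta> \<in> S"
    unfolding S_def using pr(1) by (intro AE_topological_support) (simp add: space_prob_algebra)
  \<comment> \<open>The midpoint gives no mass outside \<open>S\<close>, and both summands are
    nonnegative.\<close>
  have "(LINT \<theta>|\<pi>\<^sub>0. indicator (- S) \<theta>) + (LINT \<theta>|\<pi>\<^sub>1. indicator (- S) \<theta>) = (0::real)"
    using AE AE_iff_integral_indicator[OF pr(1) Sb] I[OF bounded_borel_indicator[of "- S"]] Sb by simp
  moreover have "0 \<le> (LINT \<theta>|\<rho>. indicator (- S) \<theta> :: real)" for \<rho> by simp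
  ultimately have AE01: "AE \<theta> in \<pi>\<^sub>0. \<theta> \<in> S" "AE \<theta> in \<pi>\<^sub>1. \<theta> \<in> S"
    unfolding AE_iff_integral_indicator[OF pr(2) Sb] AE_iff_integral_indicator[OF pr(3) Sb]
    by (smt (verit))+
  have sp: "space \<pi> = UNIV" "space \<pi>\<^sub>0 = UNIV" "space \<pi>\<^sub>1 = UNIV"
    using pr by (auto simp: space_prob_algebra dest: sets_eq_imp_space_eq)
  have m: "measure \<pi> {s} = (measure \<pi>\<^sub>0 {s} + measure \<pi>\<^sub>1 {s}) / 2" for s
    using I[OF bounded_borel_indicator[of "{s}"]] by (simp add: sp)
  obtain r where r: "0 < r" "\<forall>s\<in>S. \<forall>t\<in>S. s \<noteq> t \<longrightarrow> ball s r \<inter> ball t r = {}"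
    using finite_disjoint_balls[OF S(1)] by auto
  \<comment> \<open>The difference of the two densities at \<open>s\<close>. Where the denominator
    is 0, both masses in the numerator are 0 as well.\<close>
  define a where "a s = (measure \<pi>\<^sub>0 {s} - measure \<pi>\<^sub>1 {s}) / measure \<pi> {s}" for s
  have a: "a s * measure \<pi> {s} = measure \<pi>\<^sub>0 {s} - measure \<pi>\<^sub>1 {s}" for s
    using m[of s] measure_nonneg[of \<pi>\<^sub>0 "{s}"] measure_nonneg[of \<pi>\<^sub>1 "{s}"]
    unfolding a_def by (cases "measure \<pi> {s} = 0") (auto simp: add_nonneg_eq_0_iff)
  \<comment> \<open>Spreading the point values over disjoint balls changes nothing almost everywhere
    and gives the form required by \<open>ker_const_on_ball\<close>.\<close>
  let ?g = "\<lambda>\<theta>. \<Sum>s\<in>S. a s * indicator (ball s r) \<theta>"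
  have ga: "?g \<theta> = a s" if "s \<in> S" "\<theta> \<in> ball s r" for s \<theta>
    using sum_indicator_disjoint_balls[OF S r(2) that] .
  have gb: "?g \<in> bounded_borel"
    by (intro bounded_borel_sum bounded_borel_cmult bounded_borel_indicator) auto
  have "(LINT \<theta>|\<pi>. ?g \<theta> * L i \<theta>) = 0" for i
  proof -
    note Lm = bounded_borel_measurable[OF L_bounded_borel]
    have "(LINT \<theta>|\<pi>. ?g \<theta> * L i \<theta>) = (\<Sum>s\<in>S. ?g s * L i s * measure \<pi> {s})"
      using bounded_borel_measurable[OF bounded_borel_mult[OF gb L_bounded_borel]]
      by (intro integral_finite_support[OF pr(1) S AE])
    also have "\<dots> = (\<Sum>s\<in>S. L i s * (measure \<pi>\<^sub>0 {s} - measure \<pi>\<^sub>1 {s}))"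
      using ga r(1) by (intro sum.cong) (auto simp: a[symmetric])
    also have "\<dots> = mix \<pi>\<^sub>0 i - mix \<pi>\<^sub>1 i"
      unfolding mix_def integral_finite_support[OF pr(2) S AE01(1) Lm] integral_finite_support[OF pr(3) S AE01(2) Lm]
      by (simp add: right_diff_distrib sum_subtractf)
    finally show ?thesis using optimal_midpoint(1)[OF opt] by simp
  qed
  then have g: "?g \<in> ker \<pi>" using gb by (simp add: ker_def)
  have eq: "measure \<pi>\<^sub>0 {s} = measure \<pi>\<^sub>1 {s}" if "s \<in> S" for s
    using ker_const_on_ball[OF \<pi> agree R g r(1) ga[OF that]] a[of s] that by (simp add: S_def)
  show ?thesis
  proof (rule measure_eqI)
    show "sets \<pi>\<^sub>0 = sets \<pi>\<^sub>1" using pr by (simp add: space_prob_algebra)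
    fix A assume "A \<in> sets \<pi>\<^sub>0"
    then have A: "indicator A \<in> borel_measurable borel"
      using pr by (simp add: space_prob_algebra)
    interpret p0: prob_space \<pi>\<^sub>0 using pr by (simp add: space_prob_algebra)
    interpret p1: prob_space \<pi>\<^sub>1 using pr by (simp add: space_prob_algebra)
    have "measure \<pi>\<^sub>0 A = measure \<pi>\<^sub>1 A"
      using integral_finite_support[OF pr(2) S AE01(1) A] integral_finite_support[OF pr(3) S AE01(2) A] eq
      by (simp add: sp)
    then show "emeasure \<pi>\<^sub>0 A = emeasure \<pi>\<^sub>1 A"
      by (simp add: p0.emeasure_eq_measure p1.emeasure_eq_measure)
  qed
qed

end

section \<open>Gaussian densities\<close>

lemma sym_pos_def_dot: "sym_pos_def S \<Longrightarrow> (S *v a) \<bullet> b = a \<bullet> (S *v b)"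
  by (metis dot_lmul_matrix sym_pos_def_def transpose_matrix_vector)

lemma sym_pos_def_invertible:
  assumes "sym_pos_def S"
  shows "invertible S"
proof -
  have "inj ((*v) S)"
  proof (rule injI)
    fix x y assume "S *v x = S *v y"
    then have "S *v (x - y) = 0" by (simp add: matrix_vector_mult_diff_distrib)
    then show "x = y"
      using assms unfolding sym_pos_def_def by (metis inner_zero_right less_irrefl right_minus_eq)
  qed
  then show ?thesis
    using invertible_left_inverse matrix_left_invertible_injective by blast
qed

lemma sym_pos_def_matrix_inv:
  assumes "sym_pos_def S"
  shows "S *v (matrix_inv S *v z) = z" "matrix_inv S *v (S *v z) = z"
proof -
  have "S ** matrix_inv S = mat 1 \<and> matrix_inv S ** S = mat 1"
    using sym_pos_def_invertible[OF assms] unfolding invertible_def matrix_inv_def by (rule someI_ex)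
  then show "S *v (matrix_inv S *v z) = z" "matrix_inv S *v (S *v z) = z"
    by (simp_all add: matrix_vector_mul_assoc)
qed

text \<open>Every matrix on the segment from the identity to \<open>S\<close> is positive definite,
  hence invertible, so the determinant cannot change sign from its value 1 at the identity.\<close>

lemma sym_pos_def_det_pos:
  fixes S :: "real^'d^'d"
  assumes "sym_pos_def S"
  shows "0 < det S"
proof (rule ccontr)
  let ?P = "\<lambda>t::real. (1 - t) *\<^sub>R mat 1 + t *\<^sub>R S"
  assume "\<not> 0 < det S"
  moreover have "continuous_on {0..1} (\<lambda>t. det (?P t))"
    unfolding det_def by (intro continuous_intros)
  ultimately obtain t where t: "0 \<le> t" "t \<le> 1" "det (?P t) = 0"
    using IVT2'[of "\<lambda>t. det (?P t)" 1 0 0] by (auto simp: not_less)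
  have "sym_pos_def (?P t)"
    unfolding sym_pos_def_def
  proof (intro conjI allI impI)
    show "transpose (?P t) = ?P t"
      using assms by (simp add: sym_pos_def_def transpose_def vec_eq_iff mat_def)
    fix z :: "real^'d" assume z: "z \<noteq> 0"
    have "z \<bullet> (?P t *v z) = (1 - t) * (z \<bullet> z) + t * (z \<bullet> (S *v z))"
      by (simp add: matrix_vector_mult_add_rdistrib scaleR_matrix_vector_assoc[symmetric] inner_add_right)
    moreover have "0 < z \<bullet> z" "0 < z \<bullet> (S *v z)"
      using z assms by (auto simp: sym_pos_def_def)
    ultimately show "0 < z \<bullet> (?P t *v z)"
      using t(1,2) by (cases "t = 0") (auto intro: add_nonneg_pos)
  qed
  then show False
    using t(3) sym_pos_def_invertible invertible_det_nz by blast
qed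

text \<open>The constant is the minimum of the quadratic form on the compact unit sphere;
  homogeneity extends the bound. Positivity comes from substituting
  \<open>z = S *v w\<close>.\<close>

lemma matrix_inv_coercive:
  fixes S :: "real^'d^'d"
  assumes "sym_pos_def S"
  shows "\<exists>c>0. \<forall>z. c * (norm z)\<^sup>2 \<le> z \<bullet> (matrix_inv S *v z)"
proof -
  let ?Q = "\<lambda>z. z \<bullet> (matrix_inv S *v z)"
  have pos: "0 < ?Q z" if "z \<noteq> 0" for z
  proof -
    let ?w = "matrix_inv S *v z"
    have "?w \<noteq> 0" using that sym_pos_def_matrix_inv(1)[OF assms, of z] by auto
    then have "0 < ?w \<bullet> (S *v ?w)" using assms by (simp add: sym_pos_def_def)
    then show ?thesis by (simp add: sym_pos_def_matrix_inv[OF assms] inner_commute)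
  qed
  have "\<exists>x\<in>sphere 0 1. \<forall>y\<in>sphere 0 1. ?Q x \<le> ?Q y"
    by (intro continuous_attains_inf continuous_intros) auto
  then obtain x where x: "norm x = 1" "\<And>y. norm y = 1 \<Longrightarrow> ?Q x \<le> ?Q y" by auto
  have "?Q x * (norm z)\<^sup>2 \<le> ?Q z" for z
  proof (cases "z = 0")
    case False
    have "?Q (norm z *\<^sub>R y) = (norm z)\<^sup>2 * ?Q y" for y
      by (simp add: matrix_vector_mult_scaleR power2_eq_square)
    from this[of "sgn z"] have "?Q z = (norm z)\<^sup>2 * ?Q (sgn z)"
      using False by (simp add: sgn_div_norm)
    then show ?thesis
      using x(2)[of "sgn z"] False by (simp add: norm_sgn mult.commute mult_left_mono)
  qed simp
  moreover have "0 < ?Q x" using x(1) by (intro pos) auto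
  ultimately show ?thesis by blast
qed

lemma gauss_density_pos: "sym_pos_def S \<Longrightarrow> 0 < gauss_density S z"
  using sym_pos_def_det_pos[of S] by (simp add: gauss_density_def)

lemma gauss_density_le:
  assumes "sym_pos_def S"
  shows "gauss_density S z \<le> gauss_density S 0"
proof -
  obtain c where "0 < c" "c * (norm z)\<^sup>2 \<le> z \<bullet> (matrix_inv S *v z)"
    using matrix_inv_coercive[OF assms] by blast
  then have "0 \<le> z \<bullet> (matrix_inv S *v z)"
    by (meson less_imp_le mult_nonneg_nonneg order_trans zero_le_power2)
  then show ?thesis
    using sym_pos_def_det_pos[OF assms] by (auto simp: gauss_density_def intro!: divide_right_mono)
qed

lemma continuous_gauss_density: "continuous_on A (gauss_density S)"
  unfolding gauss_density_def divide_inverse by (intro continuous_intros)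

lemma gauss_density_vanish:
  fixes S :: "real^'d^'d"
  assumes "sym_pos_def S"
  shows "((\<lambda>\<theta>. gauss_density S (x - \<theta>)) \<longlongrightarrow> 0) at_infinity"
proof -
  obtain c where c: "0 < c" "\<And>z. c * (norm z)\<^sup>2 \<le> z \<bullet> (matrix_inv S *v z)"
    using matrix_inv_coercive[OF assms] by blast
  define K where "K = (2 * pi) powr (real CARD('d) / 2) * sqrt (det S)"
  have "0 < K" using sym_pos_def_det_pos[OF assms] by (simp add: K_def)
  have n: "filterlim (\<lambda>\<theta>. norm (x - \<theta>)) at_top at_infinity"
  proof (rule filterlim_at_top_mono)
    show "filterlim (\<lambda>\<theta>. - norm x + norm \<theta>) at_top at_infinity"
      by (intro filterlim_tendsto_add_at_top[OF tendsto_const] filterlim_norm_at_top)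
    show "\<forall>\<^sub>F \<theta> in at_infinity. - norm x + norm \<theta> \<le> norm (x - \<theta>)"
      by (intro always_eventually allI) (metis norm_minus_commute norm_triangle_ineq2 uminus_add_conv_diff)
  qed
  have "filterlim (\<lambda>\<theta>. - (c / 2) * (norm (x - \<theta>))\<^sup>2) at_bot at_infinity"
    using c(1) by (intro filterlim_tendsto_neg_mult_at_bot[OF tendsto_const] filterlim_pow_at_top n) auto
  then have "((\<lambda>\<theta>. exp (- (c / 2) * (norm (x - \<theta>))\<^sup>2) / K) \<longlongrightarrow> 0 / K) at_infinity"
    using \<open>0 < K\<close> by (intro tendsto_divide tendsto_const filterlim_compose[OF exp_at_bot]) auto
  then have lim: "((\<lambda>\<theta>. exp (- (c / 2) * (norm (x - \<theta>))\<^sup>2) / K) \<longlongrightarrow> 0) at_infinity"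
    by simp
  show ?thesis
  proof (rule tendsto_sandwich[OF _ _ tendsto_const lim])
    show "\<forall>\<^sub>F \<theta> in at_infinity. 0 \<le> gauss_density S (x - \<theta>)"
      using gauss_density_pos[OF assms] by (simp add: less_imp_le)
    have "gauss_density S (x - \<theta>) \<le> exp (- (c / 2) * (norm (x - \<theta>))\<^sup>2) / K" for \<theta>
      using c(2)[of "x - \<theta>"] \<open>0 < K\<close> unfolding gauss_density_def K_def[symmetric]
      by (intro divide_right_mono) auto
    then show "\<forall>\<^sub>F \<theta> in at_infinity. gauss_density S (x - \<theta>) \<le> exp (- (c / 2) * (norm (x - \<theta>))\<^sup>2) / K"
      by simp
  qed
qed

lemma bounded_borel_gauss_density:
  assumes "sym_pos_def S"
  shows "(\<lambda>\<theta>. gauss_density S (x - \<theta>)) \<in> bounded_borel"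
  using gauss_density_pos[OF assms] gauss_density_le[OF assms]
  by (intro bounded_borelI[where B="gauss_density S 0"] borel_measurable_continuous_onI
      continuous_on_compose2[OF continuous_gauss_density[of UNIV]] continuous_intros)
    (auto simp: abs_of_pos)

text \<open>Completing the square: for a shift along \<open>S *v e\<close> the inverse covariance
  cancels in the cross term, so the shift is an exponential tilt in \<open>z \<bullet> e\<close> up
  to a factor free of \<open>z\<close>.\<close>

lemma gauss_density_shift:
  assumes "sym_pos_def S"
  shows "gauss_density S (z + t *\<^sub>R (S *v e)) * exp (t\<^sup>2 / 2 * (e \<bullet> (S *v e)))
    = gauss_density S z * exp (- t * (z \<bullet> e))"
proof -
  have "(S *v e) \<bullet> (matrix_inv S *v z) = e \<bullet> z"
    by (simp add: sym_pos_def_dot[OF assms] sym_pos_def_matrix_inv[OF assms])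
  then have "(z + t *\<^sub>R (S *v e)) \<bullet> (matrix_inv S *v (z + t *\<^sub>R (S *v e)))
    = z \<bullet> (matrix_inv S *v z) + 2 * t * (z \<bullet> e) + t\<^sup>2 * (e \<bullet> (S *v e))"
    by (simp add: matrix_vector_right_distrib matrix_vector_mult_scaleR sym_pos_def_matrix_inv[OF assms]
        inner_add_left inner_add_right inner_commute power2_eq_square algebra_simps)
  then have "exp (- (1/2) * ((z + t *\<^sub>R (S *v e)) \<bullet> (matrix_inv S *v (z + t *\<^sub>R (S *v e))))) * exp (t\<^sup>2 / 2 * (e \<bullet> (S *v e)))
    = exp (- (1/2) * (z \<bullet> (matrix_inv S *v z))) * exp (- t * (z \<bullet> e))"
    unfolding exp_add[symmetric] by (simp add: algebra_simps)
  then show ?thesis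
    by (simp add: gauss_density_def)
qed

section \<open>Mixture densities along lines\<close>

lemma mixture_density_pos:
  assumes "sym_pos_def S" "\<pi> \<in> space (prob_algebra borel)"
  shows "0 < mixture_density S \<pi> x"
proof -
  interpret prob_space \<pi> using assms(2) by (simp add: space_prob_algebra)
  have "space \<pi> = UNIV" using assms(2) by (auto simp: space_prob_algebra dest: sets_eq_imp_space_eq)
  then show ?thesis
    unfolding mixture_density_def using emeasure_space_1 gauss_density_pos[OF assms(1)]
    by (intro integral_pos_prob[OF assms(2) bounded_borel_gauss_density[OF assms(1)]]) (auto simp: less_imp_le)
qed

lemma continuous_mixture_density:
  fixes S :: "real^'d^'d"
  assumes "sym_pos_def S" "\<pi> \<in> space (prob_algebra borel)"
  shows "continuous_on UNIV (mixture_density S \<pi>)"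
  unfolding continuous_on_sequentially comp_def
proof (intro ballI allI impI, elim conjE)
  fix u :: "nat \<Rightarrow> real^'d" and x assume u: "u \<longlonglongrightarrow> x"
  interpret prob_space \<pi> using assms(2) by (simp add: space_prob_algebra)
  note int = integrable_bounded_borel[OF assms(2) bounded_borel_gauss_density[OF assms(1)]]
  show "(\<lambda>n. mixture_density S \<pi> (u n)) \<longlonglongrightarrow> mixture_density S \<pi> x"
    unfolding mixture_density_def
  proof (rule integral_dominated_convergence[where w="\<lambda>_. gauss_density S 0"])
    show "AE \<theta> in \<pi>. (\<lambda>n. gauss_density S (u n - \<theta>)) \<longlonglongrightarrow> gauss_density S (x - \<theta>)"
      using continuous_gauss_density[of UNIV S]
      by (intro AE_I2 continuous_on_tendsto_compose[of UNIV "gauss_density S"] tendsto_intros u) auto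
    show "AE \<theta> in \<pi>. norm (gauss_density S (u n - \<theta>)) \<le> gauss_density S 0" for n
      using gauss_density_pos[OF assms(1)] gauss_density_le[OF assms(1)] by (intro AE_I2) (simp add: abs_of_pos)
  qed (use int in auto)
qed

lemma mixture_density_line:
  assumes "sym_pos_def S"
  shows "mixture_density S \<pi> (x + t *\<^sub>R (S *v e)) * exp (t\<^sup>2 / 2 * (e \<bullet> (S *v e)))
    = (LINT \<theta>|\<pi>. gauss_density S (x - \<theta>) * exp (- t * ((x - \<theta>) \<bullet> e)))"
proof -
  have "mixture_density S \<pi> (x + t *\<^sub>R (S *v e)) * exp (t\<^sup>2 / 2 * (e \<bullet> (S *v e)))
    = (LINT \<theta>|\<pi>. gauss_density S ((x - \<theta>) + t *\<^sub>R (S *v e)) * exp (t\<^sup>2 / 2 * (e \<bullet> (S *v e))))"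
    by (simp add: mixture_density_def algebra_simps)
  then show ?thesis
    by (simp only: gauss_density_shift[OF assms])
qed

text \<open>The exponential factor alone may be unbounded, but the tilted density is a constant
  multiple of a shifted Gaussian density.\<close>

lemma bounded_borel_gauss_density_tilt:
  assumes "sym_pos_def S"
  shows "(\<lambda>\<theta>. gauss_density S (x - \<theta>) * exp (- t * ((x - \<theta>) \<bullet> e))) \<in> bounded_borel"
proof -
  have "(\<lambda>\<theta>. exp (t\<^sup>2 / 2 * (e \<bullet> (S *v e))) * gauss_density S ((x + t *\<^sub>R (S *v e)) - \<theta>)) \<in> bounded_borel"
    by (intro bounded_borel_cmult bounded_borel_gauss_density assms)
  then show ?thesis
    unfolding gauss_density_shift[OF assms, symmetric] by (simp add: algebra_simps)
qed

text \<open>By \<open>mixture_density_line\<close> the function is the logarithm of an integral of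
  exponentials affine in \<open>t\<close>, like a cumulant generating function; the quadratic term
  compensates the Gaussian normalisation.\<close>

lemma ln_mixture_density_line_convex:
  assumes "sym_pos_def S" "\<pi> \<in> space (prob_algebra borel)"
  shows "convex_on UNIV (\<lambda>t. ln (mixture_density S \<pi> (x + t *\<^sub>R (S *v e))) + t\<^sup>2 / 2 * (e \<bullet> (S *v e)))"
proof -
  define f where "f t \<theta> = gauss_density S (x - \<theta>) * exp (- t * ((x - \<theta>) \<bullet> e))" for t \<theta>
  define G where "G t = (LINT \<theta>|\<pi>. f t \<theta>)" for t
  have fi: "integrable \<pi> (f t)" for t
    unfolding f_def by (intro integrable_bounded_borel assms bounded_borel_gauss_density_tilt)
  have G: "G t = mixture_density S \<pi> (x + t *\<^sub>R (S *v e)) * exp (t\<^sup>2 / 2 * (e \<bullet> (S *v e)))" for t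
    by (simp only: G_def f_def mixture_density_line[OF assms(1)])
  have Gpos: "0 < G t" for t
    unfolding G using mixture_density_pos[OF assms] by simp
  have lnG: "ln (mixture_density S \<pi> (x + t *\<^sub>R (S *v e))) + t\<^sup>2 / 2 * (e \<bullet> (S *v e)) = ln (G t)" for t
    unfolding G using mixture_density_pos[OF assms, of "x + t *\<^sub>R (S *v e)"] by (simp add: ln_mult)
  interpret prob_space \<pi> using assms(2) by (simp add: space_prob_algebra)
  show ?thesis
    unfolding lnG
  proof (rule convex_onI)
    fix l a b :: real assume l: "0 < l" "l < 1"
    let ?t = "(1 - l) *\<^sub>R a + l *\<^sub>R b"
    let ?c = "(1 - l) * ln (G a) + l * ln (G b)"
    \<comment> \<open>Pointwise convexity of \<open>exp\<close>, after dividing by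
      \<open>G a\<close> and \<open>G b\<close> so that the right-hand side integrates to 1; this
      replaces an appeal to Hoelder.\<close>
    have "f ?t \<theta> * exp (- ?c) \<le> (1 - l) * (f a \<theta> / G a) + l * (f b \<theta> / G b)" for \<theta>
    proof -
      let ?u = "\<lambda>t. ln (gauss_density S (x - \<theta>)) - t * ((x - \<theta>) \<bullet> e)"
      have f: "f t \<theta> = exp (?u t)" for t
        using gauss_density_pos[OF assms(1), of "x - \<theta>"] by (simp add: f_def exp_diff exp_minus divide_inverse)
      have "f ?t \<theta> * exp (- ?c) = exp ((1 - l) *\<^sub>R (?u a - ln (G a)) + l *\<^sub>R (?u b - ln (G b)))"
        unfolding f exp_add[symmetric] by (simp add: algebra_simps)
      also have "\<dots> \<le> (1 - l) * exp (?u a - ln (G a)) + l * exp (?u b - ln (G b))"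
        using l by (intro convex_onD[OF exp_convex]) auto
      also have "\<dots> = (1 - l) * (f a \<theta> / G a) + l * (f b \<theta> / G b)"
        unfolding f using Gpos by (simp add: exp_diff)
      finally show ?thesis .
    qed
    then have "(LINT \<theta>|\<pi>. f ?t \<theta> * exp (- ?c)) \<le> (LINT \<theta>|\<pi>. (1 - l) * (f a \<theta> / G a) + l * (f b \<theta> / G b))"
      by (intro integral_mono) (auto simp: fi)
    also have "\<dots> = (1 - l) * (G a / G a) + l * (G b / G b)"
      by (subst Bochner_Integration.integral_add) (auto simp: fi G_def)
    also have "\<dots> = 1" using Gpos less_imp_neq[OF Gpos, symmetric] by simp
    finally have "G ?t * exp (- ?c) \<le> 1" by (simp add: G_def)
    moreover have "g \<le> exp c" if "g * exp (- c) \<le> 1" for g c :: real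
      using that by (simp add: exp_minus field_simps)
    ultimately have "G ?t \<le> exp ?c" by blast
    then have "ln (G ?t) \<le> ln (exp ?c)"
      using Gpos by (simp only: ln_le_cancel_iff exp_gt_zero)
    then show "ln (G ?t) \<le> ?c" by (simp only: ln_exp)
  qed simp
qed

section \<open>Almost every data vector\<close>

abbreviation gauss_likelihood :: "('n::finite \<Rightarrow> real^'d^'d) \<Rightarrow> (real^'d)^'n \<Rightarrow> 'n \<Rightarrow> real^'d \<Rightarrow> real" where
  "gauss_likelihood \<Sigma> X \<equiv> \<lambda>i \<theta>. gauss_density (\<Sigma> i) (X $ i - \<theta>)"

text \<open>All maximisers share the value, so the choice is immaterial once one exists.\<close>

definition max_log_lik :: "('n::finite \<Rightarrow> real^'d^'d) \<Rightarrow> (real^'d)^'n \<Rightarrow> real" where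
  "max_log_lik \<Sigma> X = log_lik \<Sigma> X (SOME \<pi>. is_npmle \<Sigma> X \<pi>)"

definition line_second_difference ::
  "('n::finite \<Rightarrow> real^'d^'d) \<Rightarrow> (real^'d)^'n \<Rightarrow> nat \<Rightarrow> (real^'d)^'n \<Rightarrow> real" where
  "line_second_difference \<Sigma> b k X = real (Suc k) * (max_log_lik \<Sigma> (X + (1 / Suc k) *\<^sub>R b)
     + max_log_lik \<Sigma> (X - (1 / Suc k) *\<^sub>R b) - 2 * max_log_lik \<Sigma> X)"

text \<open>Displacing \<open>x\<^sub>i\<close> by \<open>\<Sigma>\<^sub>i e\<close> makes the first-order change of the \<open>i\<close>-th density
  the moment of \<open>(x\<^sub>i - \<theta>) \<bullet> e\<close>, without the inverse covariance.\<close>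

definition data_direction :: "('n::finite \<Rightarrow> real^'d^'d) \<Rightarrow> 'n \<Rightarrow> real^'d \<Rightarrow> (real^'d)^'n" where
  "data_direction \<Sigma> i e = axis i (\<Sigma> i *v e)"

definition exceptional_data :: "('n::finite \<Rightarrow> real^'d^'d) \<Rightarrow> ((real^'d)^'n) set" where
  "exceptional_data \<Sigma> = (\<Union>i. \<Union>e\<in>Basis.
     {X. \<not> (\<lambda>k. line_second_difference \<Sigma> (data_direction \<Sigma> i e) k X) \<longlonglongrightarrow> 0})"

text \<open>For a measure carried by the ball this is the posterior mean of the residual in
  direction \<open>e\<close>: minus the derivative of the log mixture density along
  \<open>\<Sigma> i *v e\<close>.\<close>

definition truncated_residual_mean ::
  "('n::finite \<Rightarrow> real^'d^'d) \<Rightarrow> (real^'d)^'n \<Rightarrow> real \<Rightarrow> 'n \<Rightarrow> real^'d \<Rightarrow> (real^'d) measure \<Rightarrow> real" where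
  "truncated_residual_mean \<Sigma> X R i e \<pi> =
    (LINT \<theta>|\<pi>. indicator (cball 0 R) \<theta> * ((X $ i - \<theta>) \<bullet> e) * gauss_density (\<Sigma> i) (X $ i - \<theta>))
      / mixture_density (\<Sigma> i) \<pi> (X $ i)"

lemma log_lik_line:
  "log_lik \<Sigma> (X + t *\<^sub>R data_direction \<Sigma> i e) \<pi>
    = (\<Sum>j\<in>UNIV - {i}. ln (mixture_density (\<Sigma> j) \<pi> (X $ j)))
      + ln (mixture_density (\<Sigma> i) \<pi> (X $ i + t *\<^sub>R (\<Sigma> i *v e)))"
  unfolding log_lik_def data_direction_def
  by (subst sum.remove[of UNIV i]) (auto simp: axis_def add.commute intro!: sum.cong)

lemma log_lik_remove:
  "log_lik \<Sigma> X \<pi> = (\<Sum>j\<in>UNIV - {i}. ln (mixture_density (\<Sigma> j) \<pi> (X $ j)))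
      + ln (mixture_density (\<Sigma> i) \<pi> (X $ i))"
  unfolding log_lik_def by (subst sum.remove[of UNIV i]) auto

section \<open>The maximal log likelihood as a function of the data\<close>

context
  fixes \<Sigma> :: "'n::finite \<Rightarrow> real^'d^'d"
  assumes spd: "\<And>i. sym_pos_def (\<Sigma> i)"
begin

lemma likelihood_family_gauss: "likelihood_family (gauss_likelihood \<Sigma> X)"
proof
  show "continuous_on UNIV (gauss_likelihood \<Sigma> X i)" for i
    by (intro continuous_on_compose2[OF continuous_gauss_density[of UNIV]] continuous_intros) auto
qed (auto intro: gauss_density_pos gauss_density_vanish spd)

lemma mix_gauss: "likelihood_family.mix (gauss_likelihood \<Sigma> X) \<pi> i = mixture_density (\<Sigma> i) \<pi> (X $ i)"
  by (simp add: likelihood_family.mix_def[OF likelihood_family_gauss] mixture_density_def)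

lemma optimal_gauss: "likelihood_family.optimal (gauss_likelihood \<Sigma> X) = is_npmle \<Sigma> X"
proof -
  have "likelihood_family.loglik (gauss_likelihood \<Sigma> X) = log_lik \<Sigma> X"
    by (simp add: fun_eq_iff likelihood_family.loglik_def[OF likelihood_family_gauss] log_lik_def mix_gauss)
  then show ?thesis
    by (simp add: likelihood_family.optimal_def[OF likelihood_family_gauss] is_npmle_def)
qed

lemma is_npmle_prob: "is_npmle \<Sigma> X \<pi> \<Longrightarrow> \<pi> \<in> space (prob_algebra borel)"
  by (simp add: is_npmle_def is_arg_max_def)

lemma is_npmle_le: "is_npmle \<Sigma> X \<pi> \<Longrightarrow> \<rho> \<in> space (prob_algebra borel) \<Longrightarrow> log_lik \<Sigma> X \<rho> \<le> log_lik \<Sigma> X \<pi>"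
  by (auto simp: is_npmle_def is_arg_max_def not_less)

lemma is_npmle_exists: "\<exists>\<pi>. is_npmle \<Sigma> X \<pi>"
  using likelihood_family.optimal_exists[OF likelihood_family_gauss, of X] by (simp add: optimal_gauss)

lemma max_log_lik_attained: "\<exists>\<pi>\<in>space (prob_algebra borel). max_log_lik \<Sigma> X = log_lik \<Sigma> X \<pi>"
  unfolding max_log_lik_def using someI_ex[OF is_npmle_exists] is_npmle_prob by blast

lemma log_lik_le_max: "\<pi> \<in> space (prob_algebra borel) \<Longrightarrow> log_lik \<Sigma> X \<pi> \<le> max_log_lik \<Sigma> X"
  unfolding max_log_lik_def using someI_ex[OF is_npmle_exists] is_npmle_le by blast

lemma is_npmle_max: "is_npmle \<Sigma> X \<pi> \<Longrightarrow> log_lik \<Sigma> X \<pi> = max_log_lik \<Sigma> X"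
  using max_log_lik_attained[of X] log_lik_le_max is_npmle_le is_npmle_prob by (metis antisym)

text \<open>A supremum of convex functions: the maximiser at the intermediate point competes at both
  end points, and only its \<open>i\<close>-th summand varies along the line.\<close>

lemma max_log_lik_line_convex:
  "convex_on UNIV (\<lambda>t. max_log_lik \<Sigma> (X + t *\<^sub>R data_direction \<Sigma> i e) + t\<^sup>2 / 2 * (e \<bullet> (\<Sigma> i *v e)))"
    (is "convex_on UNIV ?w")
proof (rule convex_onI)
  fix l a b :: real assume l: "0 < l" "l < 1"
  let ?t = "(1 - l) *\<^sub>R a + l *\<^sub>R b"
  obtain \<pi> where \<pi>: "\<pi> \<in> space (prob_algebra borel)"
    "max_log_lik \<Sigma> (X + ?t *\<^sub>R data_direction \<Sigma> i e) = log_lik \<Sigma> (X + ?t *\<^sub>R data_direction \<Sigma> i e) \<pi>"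
    using max_log_lik_attained by blast
  let ?s = "\<Sum>j\<in>UNIV - {i}. ln (mixture_density (\<Sigma> j) \<pi> (X $ j))"
  let ?f = "\<lambda>t. ln (mixture_density (\<Sigma> i) \<pi> (X $ i + t *\<^sub>R (\<Sigma> i *v e))) + t\<^sup>2 / 2 * (e \<bullet> (\<Sigma> i *v e))"
  have le: "?s + ?f t \<le> ?w t" for t
    using log_lik_le_max[OF \<pi>(1), of "X + t *\<^sub>R data_direction \<Sigma> i e"] by (simp add: log_lik_line)
  have "?w ?t = ?s + ?f ?t"
    by (simp only: \<pi>(2) log_lik_line add.assoc)
  also have "?f ?t \<le> (1 - l) * ?f a + l * ?f b"
    using l by (intro convex_onD[OF ln_mixture_density_line_convex[OF spd \<pi>(1)]]) auto
  then have "?s + ?f ?t \<le> (1 - l) * (?s + ?f a) + l * (?s + ?f b)"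
    by (simp add: algebra_simps)
  also have "\<dots> \<le> (1 - l) * ?w a + l * ?w b"
    by (rule add_mono[OF mult_left_mono[OF le] mult_left_mono[OF le]]) (use l in auto)
  finally show "?w ?t \<le> (1 - l) * ?w a + l * ?w b" .
qed simp

text \<open>Lower semicontinuity: a strict superlevel set is a union, possibly uncountable, of open
  superlevel sets of the continuous functions belonging to fixed measures.\<close>

lemma max_log_lik_measurable: "max_log_lik \<Sigma> \<in> borel_measurable borel"
proof (rule borel_measurableI_greater)
  fix a
  have "continuous_on UNIV (\<lambda>X. log_lik \<Sigma> X \<pi>)" if "\<pi> \<in> space (prob_algebra borel)" for \<pi>
    unfolding log_lik_def
    using mixture_density_pos[OF spd that, THEN less_imp_neq, symmetric]
    by (intro continuous_intros continuous_on_compose2[OF continuous_mixture_density[OF spd that]]) auto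
  then have "open {X. a < log_lik \<Sigma> X \<pi>}" if "\<pi> \<in> space (prob_algebra borel)" for \<pi>
    using that by (intro open_Collect_less continuous_intros) auto
  then have "open (\<Union>\<pi>\<in>space (prob_algebra borel). {X. a < log_lik \<Sigma> X \<pi>})"
    by blast
  also have "(\<Union>\<pi>\<in>space (prob_algebra borel). {X. a < log_lik \<Sigma> X \<pi>}) = {X. a < max_log_lik \<Sigma> X}"
  proof (intro equalityI subsetI)
    fix X assume "X \<in> {X. a < max_log_lik \<Sigma> X}"
    then show "X \<in> (\<Union>\<pi>\<in>space (prob_algebra borel). {X. a < log_lik \<Sigma> X \<pi>})"
      using max_log_lik_attained[of X] by auto
  qed (auto intro: less_le_trans[OF _ log_lik_le_max])
  finally show "{X \<in> space borel. a < max_log_lik \<Sigma> X} \<in> sets borel"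
    by simp
qed

text \<open>On each line parallel to a data direction the bad points are countable by convexity; the
  quadratic correction changes the scaled second difference only by
  \<open>?\<kappa> / Suc k\<close>, which tends to 0. Finitely many directions are involved.\<close>

lemma null_sets_exceptional_data: "exceptional_data \<Sigma> \<in> null_sets lebesgue"
proof -
  have "{X. \<not> (\<lambda>k. line_second_difference \<Sigma> (data_direction \<Sigma> i e) k X) \<longlonglongrightarrow> 0} \<in> null_sets lborel" (is "?N \<in> _") for i e
  proof (rule null_sets_lborel_if_countable_on_lines)
    let ?b = "data_direction \<Sigma> i e"
    let ?\<kappa> = "e \<bullet> (\<Sigma> i *v e)"
    note max_log_lik_measurable[measurable]
    show "?N \<in> sets borel"
    proof (rule borel_set_not_LIMSEQ_0)
      have [measurable]: "(\<lambda>X. X + c *\<^sub>R ?b) \<in> borel_measurable borel" "(\<lambda>X. X - c *\<^sub>R ?b) \<in> borel_measurable borel" for c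
        by (intro borel_measurable_continuous_onI continuous_intros)+
      show "line_second_difference \<Sigma> ?b k \<in> borel_measurable borel" for k
        unfolding line_second_difference_def by measurable
    qed
    fix X
    let ?w = "\<lambda>t. max_log_lik \<Sigma> (X + t *\<^sub>R ?b) + t\<^sup>2 / 2 * ?\<kappa>"
    have eq: "line_second_difference \<Sigma> ?b k (X + t *\<^sub>R ?b)
      = real (Suc k) * (?w (t + 1 / Suc k) + ?w (t - 1 / Suc k) - 2 * ?w t) - ?\<kappa> / Suc k" for k t
    proof -
      have "(t + h)\<^sup>2 / 2 * \<kappa> + (t - h)\<^sup>2 / 2 * \<kappa> - 2 * (t\<^sup>2 / 2 * \<kappa>) = h\<^sup>2 * \<kappa>" for h \<kappa> :: real
        by (simp add: power2_eq_square field_simps)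
      from this[of "1 / Suc k" ?\<kappa>] have "real (Suc k) * ((t + 1 / Suc k)\<^sup>2 / 2 * ?\<kappa> + (t - 1 / Suc k)\<^sup>2 / 2 * ?\<kappa> - 2 * (t\<^sup>2 / 2 * ?\<kappa>))
        = ?\<kappa> / Suc k"
        by (simp only:) (simp add: power2_eq_square del: of_nat_Suc)
      then show ?thesis
        unfolding line_second_difference_def by (simp add: algebra_simps)
    qed
    have lim: "(\<lambda>k. ?\<kappa> / Suc k) \<longlonglongrightarrow> 0"
      using tendsto_mult_left[OF LIMSEQ_inverse_real_of_nat, of ?\<kappa>] by (simp add: divide_inverse)
    have "(\<lambda>k. line_second_difference \<Sigma> ?b k (X + t *\<^sub>R ?b)) \<longlonglongrightarrow> 0"
      if "(\<lambda>k. real (Suc k) * (?w (t + 1 / Suc k) + ?w (t - 1 / Suc k) - 2 * ?w t)) \<longlonglongrightarrow> 0" for t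
      unfolding eq using tendsto_diff[OF that lim] by (simp only: diff_0_right)
    then show "countable {t. X + t *\<^sub>R ?b \<in> ?N}"
      by (intro countable_subset[OF _ convex_countable_nonzero_symmetric_difference[OF max_log_lik_line_convex]]) blast
  qed
  then have "exceptional_data \<Sigma> \<in> null_sets lborel"
    unfolding exceptional_data_def by (intro null_sets.finite_UN) auto
  then show ?thesis
    by (rule null_sets_completionI)
qed

text \<open>Only the inequality \<open>exp y \<ge> 1 + y\<close> is needed: the maximal log likelihood dominates the
  log likelihood of each maximiser along the line.\<close>

lemma max_log_lik_line_lower_bound:
  assumes opt: "is_npmle \<Sigma> X \<pi>" and R: "AE \<theta> in \<pi>. \<theta> \<in> cball 0 R"
    and m: "m = truncated_residual_mean \<Sigma> X R i e \<pi>" and h: "\<bar>h * m\<bar> < 1"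
  shows "max_log_lik \<Sigma> X + ln (1 - h * m) - h\<^sup>2 / 2 * (e \<bullet> (\<Sigma> i *v e))
    \<le> max_log_lik \<Sigma> (X + h *\<^sub>R data_direction \<Sigma> i e)"
proof -
  let ?\<kappa> = "e \<bullet> (\<Sigma> i *v e)"
  let ?\<phi> = "\<lambda>\<theta>. gauss_density (\<Sigma> i) (X $ i - \<theta>)"
  let ?C = "indicator (cball 0 R) :: real^'d \<Rightarrow> real"
  note \<pi> = is_npmle_prob[OF opt]
  define u where "u = mixture_density (\<Sigma> i) \<pi> (X $ i)"
  have u: "0 < u" unfolding u_def by (rule mixture_density_pos[OF spd \<pi>])
  let ?p = "mixture_density (\<Sigma> i) \<pi> (X $ i + h *\<^sub>R (\<Sigma> i *v e))"
  have p: "0 < ?p" by (rule mixture_density_pos[OF spd \<pi>])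
  have bb: "(\<lambda>\<theta>. ?C \<theta> * ((X $ i - \<theta>) \<bullet> e) * ?\<phi> \<theta>) \<in> bounded_borel"
    by (intro bounded_borel_mult[OF bounded_borel_continuous_compact bounded_borel_gauss_density[OF spd]] continuous_intros) auto
  have "u * (1 - h * m) = (LINT \<theta>|\<pi>. ?\<phi> \<theta>) - h * (LINT \<theta>|\<pi>. ?C \<theta> * ((X $ i - \<theta>) \<bullet> e) * ?\<phi> \<theta>)"
    using u unfolding m truncated_residual_mean_def u_def[symmetric] by (simp add: u_def mixture_density_def field_simps)
  also have "\<dots> = (LINT \<theta>|\<pi>. ?\<phi> \<theta> - h * (?C \<theta> * ((X $ i - \<theta>) \<bullet> e) * ?\<phi> \<theta>))"
    by (simp add: integrable_bounded_borel[OF \<pi>] bb bounded_borel_gauss_density[OF spd])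
  also have "\<dots> \<le> (LINT \<theta>|\<pi>. ?\<phi> \<theta> * exp (- h * ((X $ i - \<theta>) \<bullet> e)))"
  proof (rule integral_mono_AE)
    show "integrable \<pi> (\<lambda>\<theta>. ?\<phi> \<theta> - h * (?C \<theta> * ((X $ i - \<theta>) \<bullet> e) * ?\<phi> \<theta>))"
      by (simp add: integrable_bounded_borel[OF \<pi>] bb bounded_borel_gauss_density[OF spd])
    show "integrable \<pi> (\<lambda>\<theta>. ?\<phi> \<theta> * exp (- h * ((X $ i - \<theta>) \<bullet> e)))"
      by (rule integrable_bounded_borel[OF \<pi> bounded_borel_gauss_density_tilt[OF spd]])
    show "AE \<theta> in \<pi>. ?\<phi> \<theta> - h * (?C \<theta> * ((X $ i - \<theta>) \<bullet> e) * ?\<phi> \<theta>) \<le> ?\<phi> \<theta> * exp (- h * ((X $ i - \<theta>) \<bullet> e))"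
      using R
    proof eventually_elim
      case (elim \<theta>)
      have "?\<phi> \<theta> * (1 + - h * ((X $ i - \<theta>) \<bullet> e)) \<le> ?\<phi> \<theta> * exp (- h * ((X $ i - \<theta>) \<bullet> e))"
        using gauss_density_pos[OF spd, of i "X $ i - \<theta>"] by (intro mult_left_mono exp_ge_add_one_self) simp
      then show ?case using elim by (simp add: algebra_simps)
    qed
  qed
  also have "\<dots> = ?p * exp (h\<^sup>2 / 2 * ?\<kappa>)"
    by (simp only: mixture_density_line[OF spd])
  finally have "ln (u * (1 - h * m)) \<le> ln (?p * exp (h\<^sup>2 / 2 * ?\<kappa>))"
    using u h p by (subst ln_le_cancel_iff) (auto simp: abs_less_iff)
  then have "ln u + ln (1 - h * m) \<le> ln ?p + h\<^sup>2 / 2 * ?\<kappa>"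
    using u h p by (simp add: ln_mult abs_less_iff)
  moreover have "max_log_lik \<Sigma> X = (\<Sum>j\<in>UNIV - {i}. ln (mixture_density (\<Sigma> j) \<pi> (X $ j))) + ln u"
    unfolding is_npmle_max[OF opt, symmetric] u_def by (rule log_lik_remove)
  moreover have "(\<Sum>j\<in>UNIV - {i}. ln (mixture_density (\<Sigma> j) \<pi> (X $ j))) + ln ?p
    \<le> max_log_lik \<Sigma> (X + h *\<^sub>R data_direction \<Sigma> i e)"
    using log_lik_le_max[OF \<pi>, of "X + h *\<^sub>R data_direction \<Sigma> i e"] by (simp only: log_lik_line)
  ultimately show ?thesis by simp
qed

text \<open>The forward step is bounded below with \<open>\<pi>\<^sub>1\<close> and the backward
  step with \<open>\<pi>\<^sub>0\<close>. Their sum bounds the scaled second difference from below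
  by the difference of the two means up to an error linear in the step, and its limit is 0.\<close>

lemma moments_le_if_not_exceptional:
  assumes X: "X \<notin> exceptional_data \<Sigma>" and e: "e \<in> Basis"
    and opt: "is_npmle \<Sigma> X \<pi>\<^sub>0" "is_npmle \<Sigma> X \<pi>\<^sub>1"
    and R: "AE \<theta> in \<pi>\<^sub>0. \<theta> \<in> cball 0 R" "AE \<theta> in \<pi>\<^sub>1. \<theta> \<in> cball 0 R"
  shows "truncated_residual_mean \<Sigma> X R i e \<pi>\<^sub>0 \<le> truncated_residual_mean \<Sigma> X R i e \<pi>\<^sub>1"
proof -
  define m where "m = truncated_residual_mean \<Sigma> X R i e"
  let ?q = "\<lambda>k. line_second_difference \<Sigma> (data_direction \<Sigma> i e) k X"
  let ?\<kappa> = "e \<bullet> (\<Sigma> i *v e)"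
  let ?V = "max_log_lik \<Sigma>"
  have q: "?q \<longlonglongrightarrow> 0"
    using X e by (auto simp: exceptional_data_def)
  \<comment> \<open>Collects the coefficients of the step size: two remainders of the logarithm and
    the quadratic corrections of both steps.\<close>
  define c where "c = 2 * (m \<pi>\<^sub>0)\<^sup>2 + 2 * (m \<pi>\<^sub>1)\<^sup>2 + ?\<kappa>"
  have h0: "(\<lambda>k. 1 / real (Suc k)) \<longlonglongrightarrow> 0"
    using LIMSEQ_inverse_real_of_nat by (simp add: inverse_eq_divide)
  have small: "\<forall>\<^sub>F k in sequentially. 1 / real (Suc k) * \<bar>a\<bar> < 1/2" for a
    using order_tendstoD(2)[OF tendsto_mult_right[OF h0, of "\<bar>a\<bar>"], of "1/2"] by simp
  have "\<forall>\<^sub>F k in sequentially. (m \<pi>\<^sub>1 - m \<pi>\<^sub>0) * (-1) + - (1 / real (Suc k)) * c \<le> ?q k"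
    using small[of "m \<pi>\<^sub>0"] small[of "m \<pi>\<^sub>1"]
  proof eventually_elim
    case (elim k)
    define h where "h = 1 / real (Suc k)"
    have h: "0 < h" "real (Suc k) = 1 / h" by (auto simp: h_def)
    note el = elim[folded h_def]
    have "?V X + ln (1 + h * m \<pi>\<^sub>0) - h\<^sup>2 / 2 * ?\<kappa> \<le> ?V (X - h *\<^sub>R data_direction \<Sigma> i e)"
      using max_log_lik_line_lower_bound[OF opt(1) R(1), of "m \<pi>\<^sub>0" i e "- h"] el(1) h(1)
      by (simp add: m_def abs_mult)
    moreover have "?V X + ln (1 + h * - m \<pi>\<^sub>1) - h\<^sup>2 / 2 * ?\<kappa> \<le> ?V (X + h *\<^sub>R data_direction \<Sigma> i e)"
      using max_log_lik_line_lower_bound[OF opt(2) R(2), of "m \<pi>\<^sub>1" i e h] el(2) h(1)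
      by (simp add: m_def abs_mult)
    ultimately have "(ln (1 + h * m \<pi>\<^sub>0) + ln (1 + h * - m \<pi>\<^sub>1) - h\<^sup>2 * ?\<kappa>) / h \<le> ?q k"
      unfolding line_second_difference_def h_def[symmetric] h(2)
      using h(1) by (simp add: divide_right_mono)
    moreover have "m \<pi>\<^sub>0 - 2 * h * (m \<pi>\<^sub>0)\<^sup>2 \<le> ln (1 + h * m \<pi>\<^sub>0) / h"
      using el(1) h(1) by (intro scaled_ln_lower_bound) auto
    moreover have "- m \<pi>\<^sub>1 - 2 * h * (- m \<pi>\<^sub>1)\<^sup>2 \<le> ln (1 + h * - m \<pi>\<^sub>1) / h"
      using el(2) h(1) by (intro scaled_ln_lower_bound) auto
    moreover have "(ln (1 + h * m \<pi>\<^sub>0) + ln (1 + h * - m \<pi>\<^sub>1) - h\<^sup>2 * ?\<kappa>) / h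
      = ln (1 + h * m \<pi>\<^sub>0) / h + ln (1 + h * - m \<pi>\<^sub>1) / h - h * ?\<kappa>"
      using h(1) by (simp add: add_divide_distrib diff_divide_distrib power2_eq_square)
    ultimately show ?case
      unfolding h_def[symmetric] by (simp add: c_def algebra_simps)
  qed
  moreover have "(\<lambda>k. (m \<pi>\<^sub>1 - m \<pi>\<^sub>0) * (-1) + - (1 / real (Suc k)) * c) \<longlonglongrightarrow> (m \<pi>\<^sub>1 - m \<pi>\<^sub>0) * (-1) + - 0 * c"
    by (intro tendsto_intros h0)
  ultimately have "(m \<pi>\<^sub>1 - m \<pi>\<^sub>0) * (-1) + - 0 * c \<le> 0"
    using tendsto_le[OF _ q] by (metis trivial_limit_sequentially)
  then show ?thesis by (simp add: m_def)
qed

text \<open>Exchanging the two maximisers turns the inequality of residual means into equality.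
  Their mixture values coincide, so the denominators cancel and the term from
  \<open>X $ i \<bullet> e\<close> drops out, leaving the moments of
  \<open>\<theta>\<close>.\<close>

lemma moments_agree_if_not_exceptional:
  assumes X: "X \<notin> exceptional_data \<Sigma>"
  shows "likelihood_family.moments_agree (gauss_likelihood \<Sigma> X)"
  unfolding likelihood_family.moments_agree_def[OF likelihood_family_gauss] optimal_gauss
proof (intro allI impI ballI)
  fix \<pi>\<^sub>0 \<pi>\<^sub>1 R i and e :: "real^'d"
  assume opt: "is_npmle \<Sigma> X \<pi>\<^sub>0" "is_npmle \<Sigma> X \<pi>\<^sub>1"
    and R: "AE \<theta> in \<pi>\<^sub>0. \<theta> \<in> cball 0 R" "AE \<theta> in \<pi>\<^sub>1. \<theta> \<in> cball 0 R" and e: "e \<in> Basis"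
  let ?\<phi> = "\<lambda>\<theta>. gauss_density (\<Sigma> i) (X $ i - \<theta>)"
  let ?u = "\<lambda>\<pi>. mixture_density (\<Sigma> i) \<pi> (X $ i)"
  let ?M = "\<lambda>\<pi>. LINT \<theta>|\<pi>. indicator (cball 0 R) \<theta> * (\<theta> \<bullet> e) * ?\<phi> \<theta>"
  have u: "?u \<pi>\<^sub>0 = ?u \<pi>\<^sub>1"
    using likelihood_family.optimal_midpoint(1)[OF likelihood_family_gauss, of X \<pi>\<^sub>0 \<pi>\<^sub>1 i] opt
    by (simp add: optimal_gauss mix_gauss)
  have upos: "0 < ?u \<pi>\<^sub>0" using opt by (intro mixture_density_pos spd is_npmle_prob)
  have M: "(LINT \<theta>|\<pi>. indicator (cball 0 R) \<theta> * ((X $ i - \<theta>) \<bullet> e) * ?\<phi> \<theta>) = (X $ i \<bullet> e) * ?u \<pi> - ?M \<pi>"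
    if "is_npmle \<Sigma> X \<pi>" "AE \<theta> in \<pi>. \<theta> \<in> cball 0 R" for \<pi>
  proof -
    note \<pi> = is_npmle_prob[OF that(1)]
    have b1: "(\<lambda>\<theta>. indicator (cball 0 R) \<theta> * (\<theta> \<bullet> e) * ?\<phi> \<theta>) \<in> bounded_borel"
      "(\<lambda>\<theta>. indicator (cball 0 R) \<theta> * ((X $ i - \<theta>) \<bullet> e) * ?\<phi> \<theta>) \<in> bounded_borel"
      by (intro bounded_borel_mult[OF bounded_borel_continuous_compact bounded_borel_gauss_density[OF spd]] continuous_intros, simp)+
    have b2: "?\<phi> \<in> bounded_borel" by (rule bounded_borel_gauss_density[OF spd])
    note i1 = integrable_bounded_borel[OF \<pi> b1(1)] integrable_bounded_borel[OF \<pi> b1(2)]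
    note i2 = integrable_bounded_borel[OF \<pi> b2]
    have "(LINT \<theta>|\<pi>. indicator (cball 0 R) \<theta> * ((X $ i - \<theta>) \<bullet> e) * ?\<phi> \<theta>)
      = (LINT \<theta>|\<pi>. (X $ i \<bullet> e) * ?\<phi> \<theta> - indicator (cball 0 R) \<theta> * (\<theta> \<bullet> e) * ?\<phi> \<theta>)"
    proof (rule integral_cong_AE)
      show "AE \<theta> in \<pi>. indicator (cball 0 R) \<theta> * ((X $ i - \<theta>) \<bullet> e) * ?\<phi> \<theta>
        = (X $ i \<bullet> e) * ?\<phi> \<theta> - indicator (cball 0 R) \<theta> * (\<theta> \<bullet> e) * ?\<phi> \<theta>"
        using that(2) by eventually_elim (simp add: inner_diff_left left_diff_distrib)
    qed (use i1 i2 in auto)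
    also have "\<dots> = (X $ i \<bullet> e) * ?u \<pi> - ?M \<pi>"
      using i1 i2 by (simp add: mixture_density_def)
    finally show ?thesis .
  qed
  have "((X $ i \<bullet> e) * ?u \<pi>\<^sub>0 - ?M \<pi>\<^sub>0) / ?u \<pi>\<^sub>0 = ((X $ i \<bullet> e) * ?u \<pi>\<^sub>1 - ?M \<pi>\<^sub>1) / ?u \<pi>\<^sub>1"
    using moments_le_if_not_exceptional[OF X e opt R, of i]
      moments_le_if_not_exceptional[OF X e opt(2,1) R(2,1), of i]
    unfolding truncated_residual_mean_def M[OF opt(1) R(1)] M[OF opt(2) R(2)] by (rule antisym)
  then show "?M \<pi>\<^sub>0 = ?M \<pi>\<^sub>1"
    using u upos by simp
qed

end

theorem theoremA1:
  fixes \<Sigma> :: "'n::finite \<Rightarrow> real^'d^'d"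
  assumes "\<And>i. sym_pos_def (\<Sigma> i)"
  shows "\<exists>N \<in> null_sets (lebesgue :: ((real^'d)^'n) measure).
           \<forall>X. X \<notin> N \<longrightarrow>
             (\<exists>!\<pi>. is_npmle \<Sigma> X \<pi>) \<and>
             (\<forall>\<pi>. is_npmle \<Sigma> X \<pi> \<longrightarrow>
                finite (topological_support \<pi>) \<and> card (topological_support \<pi>) \<le> CARD('n))"
proof (intro bexI allI impI conjI)
  show "exceptional_data \<Sigma> \<in> null_sets lebesgue"
    by (rule null_sets_exceptional_data[OF assms])
  fix X assume "X \<notin> exceptional_data \<Sigma>"
  then have agree: "likelihood_family.moments_agree (gauss_likelihood \<Sigma> X)"
    by (rule moments_agree_if_not_exceptional[OF assms])
  note fam = likelihood_family_gauss[where \<Sigma>=\<Sigma> and X=X, OF assms]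
  have opt: "likelihood_family.optimal (gauss_likelihood \<Sigma> X) = is_npmle \<Sigma> X"
    by (rule optimal_gauss[where \<Sigma>=\<Sigma>, OF assms])
  show "\<exists>!\<pi>. is_npmle \<Sigma> X \<pi>"
    using is_npmle_exists[where \<Sigma>=\<Sigma> and X=X, OF assms] likelihood_family.optimal_unique[OF fam agree] unfolding opt by blast
  fix \<pi> assume \<pi>: "is_npmle \<Sigma> X \<pi>"
  obtain R where R: "AE \<theta> in \<pi>. \<theta> \<in> cball 0 R"
    using likelihood_family.optimal_bounded_support[OF fam, of \<pi>] \<pi> unfolding opt by blast
  show "finite (topological_support \<pi>)" "card (topological_support \<pi>) \<le> CARD('n)"
    using likelihood_family.card_support_le[OF fam _ agree R] \<pi> unfolding opt by blast+
qed

end
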